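(* Up to isomorphism, exactly six simple graphs without isolated vertices (regarded as $2$-uniform hypergraphs on their vertex sets) are JM, namely: (1) the complete graph $K_4$; (2) the cycle $C_4$; (3) the cycle $C_5$; (4) the fan on $5$ vertices, obtained from a path $a-b-d-c'$ on four vertices by adding a new vertex adjacent to all four of them ($7$ edges); (5) the diamond with a pendant edge: vertices $a,b,c,d,e$ with edges $ab,bc,ac,cd,da,de$; (6) the net: a triangle $a,b,c$ together with three further vertices $a',b',c'$ and edges $aa',bb',cc'$.
   Context: For a hypergraph $\mathcal H$ on ground set $V$ (with $V=\bigcup\mathcal H$): the game $NIM_{\mathcal H}$ is played on positions $x\in\mathbb{Z}_{\ge 0}^V$; a move $x\to x'$ chooses $H\in\mathcal H$ and goes to any $x'\in\mathbb Z_{\ge0}^V$ with $x'_i<x_i$ for $i\in H$ and $x'_i=x_i$ for $i\notin H$; players alternate and the player who cannot move loses. The Sprague–Grundy function is $\mathcal G_{\mathcal H}(x)=\mathrm{mex}\{\mathcal G_{\mathcal H}(x') : x\to x' \text{ a move}\}$. The height $h_{\mathcal H}(x)$ is the maximum number of consecutive moves possible from $x$. With $e$ the all-ones vector, $m(x)=\min_{i}x_i$, $y_{\mathcal H}(x)=h_{\mathcal H}(x-m(x)e)+1$, $v_{\mathcal H}(x)=\binom{y_{\mathcal H}(x)}{2}+\big((m(x)-\binom{y_{\mathcal H}(x)}{2}-1)\bmod y_{\mathcal H}(x)\big)$ (residue in $\{0,\dots,y_{\mathcal H}(x)-1\}$), $f_{\mathcal H}(x)=h_{\mathcal H}(x)$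 if $m(x)\le\binom{y_{\mathcal H}(x)}{2}$, else $v_{\mathcal H}(x)$. $\mathcal H$ is JM if $\mathcal G_{\mathcal H}=f_{\mathcal H}$ on $\mathbb Z_{\ge0}^V$. *)

theory Defs
  imports Complex_Main "HOL-Library.FuncSet"
begin

section \<open>The game NIM on a hypergraph\<close>

text \<open>
  A hypergraph is its set of hyperedges \<open>H\<close>; its ground set is \<open>\<Union>H\<close>.
  The ground set is finite and hyperedges are nonempty (otherwise play need not terminate);
  \<open>H \<noteq> {}\<close> then makes the ground set nonempty, so that the minimum of a position exists.
\<close>

definition hypergraph :: "'a set set \<Rightarrow> bool" where
  "hypergraph H \<longleftrightarrow> finite (\<Union>H) \<and> H \<noteq> {} \<and> {} \<notin> H"

definition positions :: "'a set set \<Rightarrow> ('a \<Rightarrow> nat) set" where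
  "positions H = (\<Union>H) \<rightarrow>\<^sub>E UNIV"

definition move :: "'a set set \<Rightarrow> ('a \<Rightarrow> nat) \<Rightarrow> ('a \<Rightarrow> nat) \<Rightarrow> bool" where
  "move H x x' \<longleftrightarrow> (\<exists>h\<in>H. (\<forall>i\<in>h. x' i < x i) \<and> (\<forall>i. i \<notin> h \<longrightarrow> x' i = x i))"

definition mex :: "nat set \<Rightarrow> nat" where
  "mex S = (LEAST n. n \<notin> S)"

text \<open>
  The Sprague--Grundy function, by recursion along moves; for a hypergraph this
  recursion is well-founded, and \<open>sprague_grundy_unfold\<close> below gives its equation.
\<close>

definition sprague_grundy :: "'a set set \<Rightarrow> ('a \<Rightarrow> nat) \<Rightarrow> nat" where
  "sprague_grundy H =
     wfrec {(x', x). move H x x'} (\<lambda>G x. mex {G x' | x'. move H x x'})"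

definition height :: "'a set set \<Rightarrow> ('a \<Rightarrow> nat) \<Rightarrow> nat" where
  "height H x = Max {n. \<exists>x'. (move H ^^ n) x x'}"

lemma move_in_positions:
  assumes "x \<in> positions H" "move H x x'"
  shows "x' \<in> positions H"
  using assms unfolding positions_def move_def by (fastforce simp: PiE_iff extensional_def)

lemma move_sum_less:
  assumes "hypergraph H" "move H x x'"
  shows "sum x' (\<Union>H) < sum x (\<Union>H)"
proof -
  from assms(2) obtain h where h: "h \<in> H" "\<And>i. i \<in> h \<Longrightarrow> x' i < x i"
      "\<And>i. i \<notin> h \<Longrightarrow> x' i = x i"
    unfolding move_def by blast
  from assms(1) h(1) obtain i where "i \<in> h" "i \<in> \<Union>H"
    unfolding hypergraph_def by (metis UnionI ex_in_conv)
  moreover have "x' j \<le> x j" for j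
    using h(2,3)[of j] by (cases "j \<in> h") auto
  ultimately show ?thesis
    using assms(1) h(2) unfolding hypergraph_def by (intro sum_strict_mono_ex1) auto
qed

lemma wf_move:
  assumes "hypergraph H"
  shows "wf {(x', x). move H x x'}"
  by (rule wf_subset[OF wf_measure[of "\<lambda>x. sum x (\<Union>H)"]])
     (auto simp: move_sum_less[OF assms])

lemma sprague_grundy_unfold:
  assumes "hypergraph H"
  shows "sprague_grundy H x = mex {sprague_grundy H x' | x'. move H x x'}"
proof -
  let ?R = "{(x', x). move H x x'}"
  have "{cut (sprague_grundy H) ?R x x' | x'. move H x x'}
      = {sprague_grundy H x' | x'. move H x x'}"
    by (intro Collect_cong ex_cong1) (auto simp: cut_apply)
  then show ?thesis
    unfolding sprague_grundy_def by (subst wfrec[OF wf_move[OF assms]]) simp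
qed

lemma relpowp_move_le:
  assumes "hypergraph H" "(move H ^^ n) x x'"
  shows "n + sum x' (\<Union>H) \<le> sum x (\<Union>H)"
  using assms(2)
proof (induction n arbitrary: x')
  case (Suc n)
  then obtain z where z: "(move H ^^ n) x z" "move H z x'" by auto
  from Suc.IH[OF z(1)] move_sum_less[OF assms(1) z(2)] show ?case by linarith
qed auto

lemma finite_play_lengths:
  assumes "hypergraph H"
  shows "finite {n. \<exists>x'. (move H ^^ n) x x'}" and "{n. \<exists>x'. (move H ^^ n) x x'} \<noteq> {}"
proof -
  have "{n. \<exists>x'. (move H ^^ n) x x'} \<subseteq> {..sum x (\<Union>H)}"
    using relpowp_move_le[OF assms] by fastforce
  then show "finite {n. \<exists>x'. (move H ^^ n) x x'}" using finite_subset by blast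
  have "(move H ^^ 0) x x" by simp
  then show "{n. \<exists>x'. (move H ^^ n) x x'} \<noteq> {}" by blast
qed


section \<open>JM hypergraphs\<close>

definition min_pile :: "'a set set \<Rightarrow> ('a \<Rightarrow> nat) \<Rightarrow> nat" where
  "min_pile H x = Min (x ` \<Union>H)"

definition y_fun :: "'a set set \<Rightarrow> ('a \<Rightarrow> nat) \<Rightarrow> nat" where
  "y_fun H x = height H (\<lambda>i\<in>\<Union>H. x i - min_pile H x) + 1"

text \<open>The residue is taken over the integers, where \<open>mod\<close> has range \<open>{0..<y}\<close> for \<open>y > 0\<close>.\<close>

definition v_fun :: "'a set set \<Rightarrow> ('a \<Rightarrow> nat) \<Rightarrow> nat" where
  "v_fun H x = (y_fun H x choose 2)
     + nat ((int (min_pile H x) - int (y_fun H x choose 2) - 1) mod int (y_fun H x))"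

definition f_fun :: "'a set set \<Rightarrow> ('a \<Rightarrow> nat) \<Rightarrow> nat" where
  "f_fun H x = (if min_pile H x \<le> (y_fun H x choose 2) then height H x else v_fun H x)"

definition JM :: "'a set set \<Rightarrow> bool" where
  "JM H \<longleftrightarrow> hypergraph H \<and> (\<forall>x\<in>positions H. sprague_grundy H x = f_fun H x)"


section \<open>Graphs\<close>

type_synonym 'a graph = "'a set \<times> 'a set set"

abbreviation verts :: "'a graph \<Rightarrow> 'a set" where "verts \<equiv> fst"
abbreviation edges :: "'a graph \<Rightarrow> 'a set set" where "edges \<equiv> snd"

definition simple_graph :: "'a graph \<Rightarrow> bool" where
  "simple_graph G \<longleftrightarrow> finite (verts G) \<and> verts G \<noteq> {} \<and>
     (\<forall>e\<in>edges G. e \<subseteq> verts G \<and> card e = 2)"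

definition no_isolated_vertices :: "'a graph \<Rightarrow> bool" where
  "no_isolated_vertices G \<longleftrightarrow> (\<forall>v\<in>verts G. \<exists>e\<in>edges G. v \<in> e)"

lemma graph_as_hypergraph:
  assumes "simple_graph G" "no_isolated_vertices G"
  shows "\<Union>(edges G) = verts G" and "hypergraph (edges G)"
proof -
  show eq: "\<Union>(edges G) = verts G"
    using assms unfolding simple_graph_def no_isolated_vertices_def by blast
  show "hypergraph (edges G)"
    unfolding hypergraph_def eq using assms eq
    by (auto simp: simple_graph_def)
qed

definition graph_iso :: "'a graph \<Rightarrow> 'b graph \<Rightarrow> bool" where
  "graph_iso G G' \<longleftrightarrow>
     (\<exists>\<phi>. bij_betw \<phi> (verts G) (verts G') \<and> (\<lambda>e. \<phi> ` e) ` edges G = edges G')"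

definition complete_graph :: "nat \<Rightarrow> nat graph" where
  "complete_graph n = ({..<n}, {e. e \<subseteq> {..<n} \<and> card e = 2})"

definition cycle_graph :: "nat \<Rightarrow> nat graph" where
  "cycle_graph n = ({..<n}, {{i, (i + 1) mod n} | i. i < n})"

text \<open>The path \<open>0-1-2-3\<close> together with the apex \<open>4\<close>.\<close>

definition fan5 :: "nat graph" where
  "fan5 = ({..<5}, {{0,1}, {1,2}, {2,3}, {4,0}, {4,1}, {4,2}, {4,3}})"

text \<open>With \<open>a, b, c, d, e = 0, 1, 2, 3, 4\<close>: edges \<open>ab, bc, ac, cd, da, de\<close>.\<close>

definition pendant_diamond :: "nat graph" where
  "pendant_diamond = ({..<5}, {{0,1}, {1,2}, {0,2}, {2,3}, {3,0}, {3,4}})"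

text \<open>The triangle \<open>0, 1, 2\<close> with pendant vertices \<open>3, 4, 5\<close>.\<close>

definition net_graph :: "nat graph" where
  "net_graph = ({..<6}, {{0,1}, {1,2}, {2,0}, {0,3}, {1,4}, {2,5}})"

definition six_graphs :: "nat graph set" where
  "six_graphs =
     {complete_graph 4, cycle_graph 4, cycle_graph 5, fan5, pendant_diamond, net_graph}"

end

(*
  For graphs without isolated vertices, JM is equivalent to three conditions on the edges: every
  edge has a disjoint edge; every proper vertex subset that contains an edge contains one meeting
  all its edges; any two disjoint edges are linked by an edge ("critical graph" below).

  Sufficiency: a move never preserves the value, because an edge disjoint from the moved one keeps
  its surplus over the new minimum. Conversely, among the moves that create an empty pile, one can
  pass between any two of them by steps that change the height by at most 1 (the linking edges make
  this possible), so the heights of these moves fill an interval. The second condition makes the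
  lower end of that interval small enough, and subtracting a constant from all piles reduces all
  other cases to this one.

  Necessity: failures of the conditions are detected by 0/1 positions, except for two disjoint
  edges, where (1, 1, 3, 3) is a witness.

  Classification: an induced copy of one of the six graphs in a critical graph must be the whole
  graph by the second condition. If there is no such copy, the graph is 2K2-, C4-, C5- and K4-free,
  hence a split graph with a clique of at most 3 vertices meeting all edges, and the edges disjoint
  from those of the clique produce a fan, a diamond with a pendant edge, or a net.
*)
theory Submission
  imports Defs "HOL-Library.Multiset"
begin

section \<open>Heights as packings\<close>

definition load :: "'a set multiset \<Rightarrow> 'a \<Rightarrow> nat" where
  "load M v = size {#e \<in># M. v \<in> e#}"

lemma load_empty [simp]: "load {#} v = 0"
  by (simp add: load_def)

lemma load_add_mset [simp]: "load (add_mset e M) v = load M v + (if v \<in> e then 1 else 0)"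
  by (simp add: load_def)

lemma load_union [simp]: "load (M + N) v = load M v + load N v"
  by (simp add: load_def)

lemma load_eq_0: "(\<And>e. e \<in># M \<Longrightarrow> v \<notin> e) \<Longrightarrow> load M v = 0"
  unfolding load_def by (metis (no_types, lifting) filter_mset_False filter_mset_cong0 size_empty)

lemma load_posD: "0 < load M v \<Longrightarrow> \<exists>e. e \<in># M \<and> v \<in> e"
  using load_eq_0[of M v] by force

text \<open>Packings encode plays: the number of moves does not depend on their order, and taking a
  single stone per pile wastes nothing. The height thus becomes the optimum of a packing
  problem.\<close>

definition packing :: "'a set set \<Rightarrow> ('a \<Rightarrow> nat) \<Rightarrow> 'a set multiset \<Rightarrow> bool" where
  "packing H x M \<longleftrightarrow> set_mset M \<subseteq> H \<and> (\<forall>v. load M v \<le> x v)"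

definition dec :: "'a set \<Rightarrow> ('a \<Rightarrow> nat) \<Rightarrow> 'a \<Rightarrow> nat" where
  "dec e x v = (if v \<in> e then x v - 1 else x v)"

lemma move_dec: "e \<in> H \<Longrightarrow> (\<And>v. v \<in> e \<Longrightarrow> 0 < x v) \<Longrightarrow> move H x (dec e x)"
  unfolding move_def dec_def by (intro bexI[of _ e]) auto

text \<open>A move that takes several stones from a pile still leaves room for its hyperedge to be
  counted once, so the hyperedges played form a packing.\<close>

lemma play_imp_packing: "(move H ^^ n) x x' \<Longrightarrow> \<exists>M. packing H x M \<and> size M = n"
proof (induction n arbitrary: x)
  case 0
  then show ?case by (intro exI[of _ "{#}"]) (auto simp: packing_def)
next
  case (Suc n)
  obtain z where z: "move H x z" "(move H ^^ n) z x'"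
    using relpowp_Suc_D2[OF Suc.prems] by blast
  obtain M where M: "packing H z M" "size M = n" using Suc.IH[OF z(2)] by blast
  obtain h where h: "h \<in> H" "\<forall>i\<in>h. z i < x i" "\<forall>i. i \<notin> h \<longrightarrow> z i = x i"
    using z(1) unfolding move_def by blast
  have "load (add_mset h M) v \<le> x v" for v
  proof -
    have "load M v \<le> z v" using M(1) by (simp add: packing_def)
    then show ?thesis
      using h(2,3) by (cases "v \<in> h") (auto simp: Suc_le_eq intro: le_less_trans)
  qed
  then show ?case using h(1) M
    by (intro exI[of _ "add_mset h M"]) (auto simp: packing_def)
qed

lemma packing_dec:
  assumes "packing H x (add_mset e M)"
  shows "move H x (dec e x)" and "packing H (dec e x) M"
proof -
  have *: "load M v + (if v \<in> e then 1 else 0) \<le> x v" for v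
    using assms by (auto simp: packing_def)
  show "move H x (dec e x)"
  proof (rule move_dec)
    show "e \<in> H" using assms by (simp add: packing_def)
    show "0 < x v" if "v \<in> e" for v using *[of v] that by simp
  qed
  show "packing H (dec e x) M"
    unfolding packing_def
  proof (intro conjI allI)
    show "set_mset M \<subseteq> H" using assms by (simp add: packing_def)
    show "load M v \<le> dec e x v" for v using *[of v] by (auto simp: dec_def split: if_splits)
  qed
qed

lemma packing_imp_play: "packing H x M \<Longrightarrow> \<exists>x'. (move H ^^ size M) x x'"
proof (induction M arbitrary: x)
  case empty
  then show ?case by simp
next
  case (add e M)
  obtain x' where "(move H ^^ size M) (dec e x) x'"
    using add.IH[OF packing_dec(2)[OF add.prems]] by blast
  then have "(move H ^^ Suc (size M)) x x'"
    by (rule relpowp_Suc_I2[where P = "move H", OF packing_dec(1)[OF add.prems]])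
  then show ?case unfolding size_add_mset by blast
qed

lemma packing_mono: "packing H x M \<Longrightarrow> (\<And>v. v \<in> \<Union>H \<Longrightarrow> x v \<le> z v) \<Longrightarrow> packing H z M"
  unfolding packing_def
proof (elim conjE, intro conjI allI)
  fix v assume a: "set_mset M \<subseteq> H" "\<forall>v. load M v \<le> x v" "\<And>v. v \<in> \<Union>H \<Longrightarrow> x v \<le> z v"
  show "load M v \<le> z v"
  proof (cases "v \<in> \<Union>H")
    case True
    then show ?thesis using a(2,3) le_trans by blast
  next
    case False
    then have "load M v = 0" using a(1) by (intro load_eq_0) blast
    then show ?thesis by simp
  qed
qed auto

section \<open>Bounds for the height\<close>

locale finite_hypergraph =
  fixes H :: "'a set set"
  assumes hyp: "hypergraph H"
begin

abbreviation "ht \<equiv> height H"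

lemma play_le_height: "(move H ^^ n) x x' \<Longrightarrow> n \<le> ht x"
  unfolding height_def using finite_play_lengths[OF hyp] by (intro Max_ge) auto

lemma packing_le_height: "packing H x M \<Longrightarrow> size M \<le> ht x"
  using packing_imp_play play_le_height by blast

lemma max_packing:
  obtains M where "packing H x M" "size M = ht x"
proof -
  have "ht x \<in> {n. \<exists>x'. (move H ^^ n) x x'}"
    unfolding height_def using finite_play_lengths[OF hyp] by (intro Max_in) auto
  then show thesis using play_imp_packing that by blast
qed

lemma height_mono: "(\<And>v. v \<in> \<Union>H \<Longrightarrow> x v \<le> z v) \<Longrightarrow> ht x \<le> ht z"
  by (metis max_packing packing_le_height packing_mono)

lemma height_cong: "(\<And>v. v \<in> \<Union>H \<Longrightarrow> x v = z v) \<Longrightarrow> ht x = ht z"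
  by (intro antisym height_mono) auto

lemma height_move: "move H x x' \<Longrightarrow> ht x' < ht x"
proof -
  assume m: "move H x x'"
  obtain M where "packing H x' M" "size M = ht x'" using max_packing .
  then obtain z where "(move H ^^ ht x') x' z" using packing_imp_play[of H x' M] by auto
  then have "(move H ^^ Suc (ht x')) x z" by (rule relpowp_Suc_I2[where P = "move H", OF m])
  then show ?thesis using play_le_height by fastforce
qed

text \<open>Deleting one hyperedge through \<open>a\<close> from a maximum packing for
  \<open>z\<close> leaves a packing for \<open>x\<close>. Piles other than \<open>a\<close> may be
  lower in \<open>z\<close>, which allows comparing positions that differ in two piles.\<close>

lemma height_step:
  assumes "\<And>v. v \<in> \<Union>H \<Longrightarrow> v \<noteq> a \<Longrightarrow> z v \<le> x v" "z a \<le> Suc (x a)"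
  shows "ht z \<le> Suc (ht x)"
proof -
  obtain M where M: "packing H z M" "size M = ht z" using max_packing .
  show ?thesis
  proof (cases "\<exists>e. e \<in># M \<and> a \<in> e")
    case True
    then obtain e N where e: "a \<in> e" "M = add_mset e N" by (meson multi_member_split)
    have "packing H (dec e z) N" using packing_dec(2) M(1) e(2) by blast
    then have "packing H x N"
    proof (rule packing_mono)
      fix v assume "v \<in> \<Union>H"
      then show "dec e z v \<le> x v"
        using assms(1)[of v] assms(2) e(1) by (cases "v = a") (auto simp: dec_def)
    qed
    then show ?thesis using packing_le_height M(2) e(2) by fastforce
  next
    case False
    have "packing H (z(a := 0)) M"
      unfolding packing_def
    proof (intro conjI allI)
      show "set_mset M \<subseteq> H" using M(1) by (simp add: packing_def)
      have "load M a = 0" using False by (intro load_eq_0) blast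
      then show "load M v \<le> (z(a := 0)) v" for v using M(1) by (auto simp: packing_def)
    qed
    then have "packing H x M" by (rule packing_mono) (use assms in auto)
    then show ?thesis using packing_le_height M(2) by fastforce
  qed
qed

lemma height_add: "ht x + ht z \<le> ht (\<lambda>v. x v + z v)"
proof -
  obtain M where M: "packing H x M" "size M = ht x" using max_packing .
  obtain N where N: "packing H z N" "size N = ht z" using max_packing .
  have "packing H (\<lambda>v. x v + z v) (M + N)"
    using M(1) N(1) by (auto simp: packing_def intro: add_mono)
  then show ?thesis using packing_le_height M(2) N(2) by fastforce
qed

lemma height_edge:
  assumes "e \<in> H" "\<And>v. v \<in> e \<Longrightarrow> k \<le> x v"
  shows "k \<le> ht x"
proof -
  have "load (replicate_mset k e) v = (if v \<in> e then k else 0)" for v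
    by (induction k) auto
  then have "packing H x (replicate_mset k e)"
    using assms by (auto simp: packing_def split: if_splits)
  then show ?thesis using packing_le_height by fastforce
qed

text \<open>The \<open>k\<close> stones taken off every pile pay for \<open>k\<close> moves on
  \<open>e\<close> and \<open>k\<close> moves on \<open>e'\<close>, which use different
  piles.\<close>

lemma height_two_edges:
  assumes "e \<in> H" "e' \<in> H" "e \<inter> e' = {}" "\<And>v. v \<in> \<Union>H \<Longrightarrow> k \<le> x v"
  shows "2 * k + ht (\<lambda>v. x v - k) \<le> ht x"
proof -
  define c where "c f v = (if v \<in> f then k else 0)" for f and v :: 'a
  have "k \<le> ht (c e)" "k \<le> ht (c e')"
    using height_edge[OF assms(1)] height_edge[OF assms(2)] by (auto simp: c_def)
  then have "2 * k + ht (\<lambda>v. x v - k) \<le> ht (\<lambda>v. c e v + c e' v) + ht (\<lambda>v. x v - k)"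
    using height_add[of "c e" "c e'"] by linarith
  also have "\<dots> \<le> ht (\<lambda>v. c e v + c e' v + (x v - k))" by (rule height_add)
  also have "\<dots> \<le> ht x"
  proof (rule height_mono)
    fix v assume "v \<in> \<Union>H"
    then have "k \<le> x v" by (rule assms(4))
    moreover have "v \<notin> e \<or> v \<notin> e'" using assms(3) by blast
    ultimately show "c e v + c e' v + (x v - k) \<le> x v" by (auto simp: c_def)
  qed
  finally show ?thesis .
qed

text \<open>Weak duality: every hyperedge of a packing takes a stone from \<open>T\<close>. Only the
  hyperedges that are playable at \<open>x\<close> have to meet \<open>T\<close>.\<close>

lemma height_le_cover:
  assumes "finite T" "\<And>e. e \<in> H \<Longrightarrow> \<forall>v\<in>e. 0 < x v \<Longrightarrow> e \<inter> T \<noteq> {}"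
  shows "ht x \<le> sum x T"
proof -
  obtain M where M: "packing H x M" "size M = ht x" using max_packing .
  have "\<forall>e\<in>#M. e \<inter> T \<noteq> {}"
  proof
    fix e assume "e \<in># M"
    then obtain N where N: "M = add_mset e N" by (meson multi_member_split)
    have "0 < x v" if "v \<in> e" for v
    proof -
      have "load M v \<le> x v" using M(1) by (simp add: packing_def)
      then show ?thesis using N that by simp
    qed
    moreover have "e \<in> H" using M(1) \<open>e \<in># M\<close> by (auto simp: packing_def)
    ultimately show "e \<inter> T \<noteq> {}" using assms(2) by blast
  qed
  then have "size M \<le> (\<Sum>v\<in>T. load M v)"
  proof (induction M)
    case (add e M)
    then obtain w where "w \<in> e" "w \<in> T" by auto
    then have "1 \<le> (\<Sum>v\<in>T. if v \<in> e then 1 else 0 :: nat)"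
      using assms(1) member_le_sum[of w T "\<lambda>v. if v \<in> e then 1 else 0 :: nat"] by force
    moreover have "size M \<le> (\<Sum>v\<in>T. load M v)" using add by simp
    ultimately show ?case by (simp add: sum.distrib)
  qed simp
  also have "\<dots> \<le> sum x T" using M(1) by (intro sum_mono) (simp add: packing_def)
  finally show ?thesis using M(2) by simp
qed

text \<open>Any member of a maximum packing, played with one stone per pile, is the first move of a
  longest play.\<close>

lemma height_dec_exists:
  assumes "0 < ht x"
  obtains e where "e \<in> H" "\<forall>v\<in>e. 0 < x v" "move H x (dec e x)" "ht x = Suc (ht (dec e x))"
proof -
  obtain M where M: "packing H x M" "size M = ht x" using max_packing .
  with assms have "M \<noteq> {#}" by auto
  then obtain e N where N: "M = add_mset e N" by (meson multiset_cases)
  have "size N \<le> ht (dec e x)" using packing_dec(2) packing_le_height M(1) N by blast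
  moreover have mv: "move H x (dec e x)" using packing_dec(1) M(1) N by blast
  moreover have "e \<in> H" using M(1) N by (simp add: packing_def)
  moreover have "\<forall>v\<in>e. 0 < x v"
  proof
    fix v assume "v \<in> e"
    moreover have "load M v \<le> x v" using M(1) by (simp add: packing_def)
    ultimately show "0 < x v" using N by simp
  qed
  ultimately show thesis using that[of e] height_move[OF mv] M(2) N by simp
qed

end

section \<open>Graphs whose Sprague--Grundy function is given by the formula\<close>

context finite_hypergraph
begin

abbreviation "V \<equiv> \<Union>H"
abbreviation "mp \<equiv> min_pile H"
abbreviation "yf \<equiv> y_fun H"
abbreviation "ff \<equiv> f_fun H"

lemma finite_V: "finite V" and V_nonempty: "V \<noteq> {}"
  using hyp by (auto simp: hypergraph_def)

lemma min_pile_le: "v \<in> V \<Longrightarrow> mp x \<le> x v"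
  unfolding min_pile_def using finite_V by (intro Min_le) auto

lemma min_pile_attained: "\<exists>c\<in>V. x c = mp x"
proof -
  have "mp x \<in> x ` V"
    unfolding min_pile_def using finite_V V_nonempty by (intro Min_in) auto
  then show ?thesis by fastforce
qed

lemma min_pile_eqI: "c \<in> V \<Longrightarrow> x c = m \<Longrightarrow> (\<And>v. v \<in> V \<Longrightarrow> m \<le> x v) \<Longrightarrow> mp x = m"
  by (metis min_pile_attained min_pile_le order_antisym)

lemma y_fun_eq: "yf x = Suc (ht (\<lambda>v. x v - mp x))"
proof -
  have "ht (\<lambda>i\<in>V. x i - mp x) = ht (\<lambda>v. x v - mp x)" by (rule height_cong) simp
  then show ?thesis by (simp add: y_fun_def)
qed

lemma f_fun_min_0: "mp x = 0 \<Longrightarrow> ff x = ht x"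
  by (simp add: f_fun_def)

lemma choose_two_Suc: "Suc n choose 2 = (n choose 2) + n"
  by (simp add: numeral_2_eq_2)

lemma choose_two_mono: "m \<le> n \<Longrightarrow> m choose 2 \<le> n choose 2"
  by (induction n) (auto simp: le_Suc_eq choose_two_Suc)

text \<open>When the minimum exceeds \<open>yf x choose 2\<close> (the long case), no subtraction is
  truncated, so the residue can be taken over the natural numbers.\<close>

lemma f_fun_long:
  assumes "yf x choose 2 < mp x"
  shows "ff x = (yf x choose 2) + (mp x - (yf x choose 2) - 1) mod yf x"
proof -
  have "(int (mp x) - int (yf x choose 2) - 1) mod int (yf x)
      = int ((mp x - (yf x choose 2) - 1) mod yf x)"
    using assms by (simp add: zmod_int algebra_simps)
  then show ?thesis using assms by (simp add: f_fun_def v_fun_def)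
qed

text \<open>The residue is less than y, so the long positions with a given y have their values in a
  block of y consecutive numbers. Blocks for different y are disjoint, and the value of a long
  position therefore determines its y.\<close>

lemma f_fun_long_bounds:
  assumes "yf x choose 2 < mp x"
  shows "yf x choose 2 \<le> ff x" "ff x < Suc (yf x) choose 2" "ff x < mp x"
proof -
  have "0 < yf x" by (simp add: y_fun_eq)
  then have "(mp x - (yf x choose 2) - 1) mod yf x < yf x" by simp
  moreover have "(mp x - (yf x choose 2) - 1) mod yf x \<le> mp x - (yf x choose 2) - 1"
    by (rule mod_less_eq_dividend)
  ultimately show "yf x choose 2 \<le> ff x" "ff x < Suc (yf x) choose 2" "ff x < mp x"
    using assms unfolding f_fun_long[OF assms] choose_two_Suc by linarith+
qed

end

text \<open>In game terms, \<open>transversal_edge\<close> says that a position with piles 0 and 1,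
  an empty pile and at least one move has a move to height 0. The role of
  \<open>linking_edge\<close> is to connect moves on disjoint edges.\<close>

locale critical_graph = finite_hypergraph E for E :: "'a set set" +
  assumes card_edge: "e \<in> E \<Longrightarrow> card e = 2"
    and disjoint_edge: "e \<in> E \<Longrightarrow> \<exists>f\<in>E. e \<inter> f = {}"
    and transversal_edge: "S \<subset> \<Union>E \<Longrightarrow> \<exists>e\<in>E. e \<subseteq> S \<Longrightarrow>
          \<exists>e\<in>E. e \<subseteq> S \<and> (\<forall>f\<in>E. f \<subseteq> S \<longrightarrow> e \<inter> f \<noteq> {})"
    and linking_edge: "e \<in> E \<Longrightarrow> f \<in> E \<Longrightarrow> e \<inter> f = {} \<Longrightarrow>
          \<exists>g\<in>E. g \<subseteq> e \<union> f \<and> e \<inter> g \<noteq> {} \<and> f \<inter> g \<noteq> {}"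
begin

section \<open>Moves change the value\<close>

lemma height_ge_min_pile: "2 * mp x + yf x \<le> Suc (ht x)"
proof -
  \<comment> \<open>Play \<open>mp x\<close> times on each of two disjoint edges and then a longest
    play on the surplus; the \<open>Suc\<close> accounts for the 1 in the definition of y.\<close>
  obtain e where "e \<in> E" using hyp by (auto simp: hypergraph_def)
  moreover obtain e' where "e' \<in> E" "e \<inter> e' = {}" using disjoint_edge[OF \<open>e \<in> E\<close>] by blast
  ultimately show ?thesis
    using height_two_edges[of e e' "mp x" x] min_pile_le[of _ x] by (simp add: y_fun_eq)
qed

lemma move_le: "move E x x' \<Longrightarrow> x' v \<le> x v"
  unfolding move_def by (metis less_imp_le order_refl)

lemma min_pile_move_le: "move E x x' \<Longrightarrow> mp x' \<le> mp x"
  by (metis le_trans min_pile_attained min_pile_le move_le)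

text \<open>While the minimum stays the same, the move is also a move of the surplus position, whose
  height therefore drops.\<close>

lemma y_fun_move_less:
  assumes "move E x x'" "mp x' = mp x"
  shows "yf x' < yf x"
proof -
  have "move E (\<lambda>v. x v - mp x) (\<lambda>v. x' v - mp x)"
  proof -
    obtain h where h: "h \<in> E" "\<forall>i\<in>h. x' i < x i" "\<forall>i. i \<notin> h \<longrightarrow> x' i = x i"
      using assms(1) unfolding move_def by blast
    have "x' i - mp x < x i - mp x" if "i \<in> h" for i
      using h(1,2) that min_pile_le[of i x'] assms(2) by (metis UnionI diff_less_mono)
    then show ?thesis using h unfolding move_def by (intro bexI[of _ h]) auto
  qed
  then show ?thesis using height_move assms(2) by (simp add: y_fun_eq)
qed

text \<open>An edge disjoint from the edge of the move keeps all its surplus.\<close>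

lemma y_fun_move_greater:
  assumes "move E x x'"
  shows "mp x - mp x' < yf x'"
proof -
  obtain h where h: "h \<in> E" "\<forall>i. i \<notin> h \<longrightarrow> x' i = x i"
    using assms unfolding move_def by blast
  obtain g where g: "g \<in> E" "h \<inter> g = {}" using disjoint_edge[OF h(1)] by blast
  have "mp x - mp x' \<le> ht (\<lambda>v. x' v - mp x')"
  proof (rule height_edge[OF g(1)])
    fix v assume "v \<in> g"
    then have "x' v = x v" "mp x \<le> x v" using h(2) g min_pile_le[of v x] by blast+
    then show "mp x - mp x' \<le> x' v - mp x'" by simp
  qed
  then show ?thesis by (simp add: y_fun_eq)
qed

text \<open>Equal values of two long positions force equal y, hence minima congruent modulo y; but
  the minimum would drop by a positive amount smaller than y. In the other cases strict inequalities
  between values and heights decide.\<close>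

lemma f_fun_move_neq:
  assumes mv: "move E x x'"
  shows "ff x' \<noteq> ff x"
proof (cases "yf x choose 2 < mp x")
  case long: True
  show ?thesis
  proof (cases "yf x' choose 2 < mp x'")
    case long': True
    show ?thesis
    proof
      assume eq: "ff x' = ff x"
      note b = f_fun_long_bounds[OF long] and b' = f_fun_long_bounds[OF long']
      have "\<not> yf x < yf x'" "\<not> yf x' < yf x"
        using b b' eq choose_two_mono[of "Suc (yf x)" "yf x'"] choose_two_mono[of "Suc (yf x')" "yf x"]
        by (auto simp: Suc_le_eq)
      then have y: "yf x' = yf x" by simp
      then have "mp x' \<noteq> mp x" using y_fun_move_less[OF mv] by auto
      then have less: "mp x' < mp x" using min_pile_move_le[OF mv] by simp
      have "(mp x - (yf x choose 2) - 1) mod yf x = (mp x' - (yf x choose 2) - 1) mod yf x"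
        using eq y f_fun_long[OF long] f_fun_long[OF long'] by simp
      then have "yf x dvd (mp x - (yf x choose 2) - 1) - (mp x' - (yf x choose 2) - 1)"
        using less by (subst mod_eq_dvd_iff_nat[symmetric]) auto
      also have "(mp x - (yf x choose 2) - 1) - (mp x' - (yf x choose 2) - 1) = mp x - mp x'"
        using less long long' y by simp
      finally have "yf x \<le> mp x - mp x'" using less by (intro dvd_imp_le) auto
      then show False using y_fun_move_greater[OF mv] y by simp
    qed
  next
    case short': False
    \<comment> \<open>With an unchanged minimum y would not grow, and \<open>x'\<close> would be
      long like \<open>x\<close>.\<close>
    have "mp x' \<noteq> mp x"
    proof
      assume eq: "mp x' = mp x"
      then have "yf x' choose 2 \<le> yf x choose 2"
        using y_fun_move_less[OF mv] by (intro choose_two_mono) auto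
      then show False using eq long short' by simp
    qed
    \<comment> \<open>The height of \<open>x'\<close> is at least
      \<open>2 * mp x' + yf x' - 1\<close>, and \<open>yf x' - 1\<close> makes up for the drop of
      the minimum.\<close>
    then have "mp x \<le> ht x'"
      using min_pile_move_le[OF mv] y_fun_move_greater[OF mv] height_ge_min_pile[of x'] by simp
    then show ?thesis using short' f_fun_long_bounds(3)[OF long] by (simp add: f_fun_def)
  qed
next
  case short: False
  then have fx: "ff x = ht x" by (simp add: f_fun_def)
  show ?thesis
  proof (cases "yf x' choose 2 < mp x'")
    case True
    then have "ff x' < ht x'"
      using f_fun_long_bounds(3)[OF True] height_ge_min_pile[of x'] by (simp add: y_fun_eq)
    then show ?thesis using fx height_move[OF mv] by simp
  next
    case False
    then have "ff x' = ht x'" by (simp add: f_fun_def)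
    then show ?thesis using fx height_move[OF mv] by simp
  qed
qed

section \<open>Moves that leave an empty pile\<close>

lemma edge_endpoints:
  assumes "e \<in> E"
  obtains a b where "e = {a, b}" "a \<noteq> b"
  using card_edge[OF assms] by (auto simp: card_2_iff)

lemma edge_neq: "{a, b} \<in> E \<Longrightarrow> a \<noteq> b"
  using card_edge by fastforce

lemma edge_other_endpoint:
  assumes "e \<in> E" "a \<in> e"
  obtains b where "e = {a, b}"
proof -
  obtain c d where "e = {c, d}" using edge_endpoints[OF assms(1)] .
  then show thesis using that assms(2) by (cases "a = c") (auto simp: insert_commute)
qed

lemma incident_edge:
  assumes "a \<in> V"
  obtains b where "{a, b} \<in> E"
  using assms edge_other_endpoint by (metis UnionE)

definition zero :: "'a set \<Rightarrow> ('a \<Rightarrow> nat) \<Rightarrow> 'a \<Rightarrow> nat" where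
  "zero e x v = (if v \<in> e then 0 else x v)"

text \<open>If \<open>x\<close> already has an empty pile, these are all its moves.\<close>

definition zero_moves :: "('a \<Rightarrow> nat) \<Rightarrow> ('a \<Rightarrow> nat) set" where
  "zero_moves x = {x'. move E x x' \<and> (\<exists>v\<in>V. x' v = 0)}"

text \<open>A discrete form of continuity: a path in \<open>X\<close> whose steps change the height
  by at most 1 takes every height between those of its ends.\<close>

definition near :: "('a \<Rightarrow> nat) set \<Rightarrow> ('a \<Rightarrow> nat) \<Rightarrow> ('a \<Rightarrow> nat) \<Rightarrow> bool" where
  "near X p q \<longleftrightarrow> p \<in> X \<and> q \<in> X \<and> ht p \<le> Suc (ht q) \<and> ht q \<le> Suc (ht p)"

abbreviation "chain X \<equiv> (near X)\<^sup>*\<^sup>*"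

lemma chain_sym: "chain X p q \<Longrightarrow> chain X q p"
proof (induction rule: rtranclp_induct)
  case (step q r)
  then have "near X r q" by (simp add: near_def)
  then show ?case using step.IH by (rule converse_rtranclp_into_rtranclp)
qed simp

lemma chain_subset: "chain X p q \<Longrightarrow> X \<subseteq> Y \<Longrightarrow> chain Y p q"
  by (erule mono_rtranclp[rule_format, rotated]) (auto simp: near_def)

lemma chain_intermediate:
  "chain X p q \<Longrightarrow> p \<in> X \<Longrightarrow> ht p \<le> k \<Longrightarrow> k \<le> ht q \<Longrightarrow> \<exists>r\<in>X. ht r = k"
proof (induction rule: rtranclp_induct)
  case base
  then show ?case by force
next
  case (step q r)
  show ?case
  proof (cases "k \<le> ht q")
    case True
    then show ?thesis using step by blast
  next
    case False
    then have "ht r = k" "r \<in> X" using step.hyps(2) step.prems by (auto simp: near_def)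
    then show ?thesis by blast
  qed
qed

lemma chain_line: "(\<And>l. l \<le> i \<Longrightarrow> p(a := l) \<in> X) \<Longrightarrow> chain X (p(a := i)) (p(a := 0))"
proof (induction i)
  case (Suc i)
  have "near X (p(a := Suc i)) (p(a := i))"
    unfolding near_def
  proof (intro conjI)
    show "p(a := Suc i) \<in> X" "p(a := i) \<in> X" by (rule Suc.prems; simp)+
    show "ht (p(a := Suc i)) \<le> Suc (ht (p(a := i)))"
      "ht (p(a := i)) \<le> Suc (ht (p(a := Suc i)))"
      by (rule height_step[of a]; simp)+
  qed
  then show ?case using Suc by (meson converse_rtranclp_into_rtranclp le_SucI)
qed simp

lemma move_pair:
  "{a, b} \<in> E \<Longrightarrow> i < x a \<Longrightarrow> j < x b \<Longrightarrow> move E x (x(a := i, b := j))"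
  unfolding move_def by (intro bexI[of _ "{a, b}"]) auto

lemma zero_pair: "zero {a, b} x = x(a := 0, b := 0)"
  by (auto simp: zero_def)

text \<open>First \<open>a\<close>, then \<open>b\<close> is lowered one stone at a time. A pile
  that is empty stays empty, so the whole path lies in \<open>zero_moves x\<close>.\<close>

lemma chain_to_zero:
  assumes e: "{a, b} \<in> E" and ij: "i < x a" "j < x b" and 0: "\<exists>v\<in>V. (x(a := i, b := j)) v = 0"
  shows "chain (zero_moves x) (x(a := i, b := j)) (zero {a, b} x)"
proof -
  have ab: "a \<noteq> b" "a \<in> V" "b \<in> V" using edge_neq[OF e] e by auto
  have 1: "x(a := l, b := j) \<in> zero_moves x" if "l \<le> i" for l
  proof -
    have "move E x (x(a := l, b := j))" by (rule move_pair[OF e]) (use that ij in auto)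
    moreover obtain v where v: "v \<in> V" "(x(a := i, b := j)) v = 0" using 0 by blast
    then have "(x(a := l, b := j)) v = 0" using that ab by (auto split: if_splits)
    ultimately show ?thesis using v(1) unfolding zero_moves_def by blast
  qed
  have 2: "x(a := 0, b := l) \<in> zero_moves x" if "l \<le> j" for l
  proof -
    have "move E x (x(a := 0, b := l))" by (rule move_pair[OF e]) (use that ij in auto)
    moreover have "(x(a := 0, b := l)) a = 0" using ab by simp
    ultimately show ?thesis using ab unfolding zero_moves_def by blast
  qed
  have "chain (zero_moves x) (x(b := j, a := i)) (x(b := j, a := 0))"
  proof (rule chain_line)
    show "x(b := j, a := l) \<in> zero_moves x" if "l \<le> i" for l
      using 1[OF that] fun_upd_twist[OF ab(1), of x l j] by metis
  qed
  then have c: "chain (zero_moves x) (x(a := i, b := j)) (x(a := 0, b := j))"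
    using fun_upd_twist[OF ab(1), of x] by metis
  have "chain (zero_moves x) (x(a := 0, b := j)) (x(a := 0, b := 0))"
    using 2 by (intro chain_line) simp
  with c show ?thesis unfolding zero_pair by (rule rtranclp_trans)
qed

lemma zero_in_zero_moves:
  assumes "e \<in> E" "\<forall>v\<in>e. 0 < x v"
  shows "zero e x \<in> zero_moves x"
proof -
  have "move E x (zero e x)"
    unfolding move_def using assms by (intro bexI[of _ e]) (auto simp: zero_def)
  moreover obtain v where "v \<in> e" using edge_endpoints[OF assms(1)] by blast
  moreover have "zero e x v = 0" using \<open>v \<in> e\<close> by (simp add: zero_def)
  ultimately show ?thesis using assms(1) unfolding zero_moves_def by blast
qed

text \<open>Two moves along edges \<open>ab\<close> and \<open>ac\<close> that empty \<open>a\<close> and take one stone from \<open>b\<close>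
  or from \<open>c\<close> have almost the same height.\<close>

lemma chain_adjacent_edges:
  assumes e: "{a, b} \<in> E" "{a, c} \<in> E" and x: "0 < x a" "0 < x b" "0 < x c"
  shows "chain (zero_moves x) (zero {a, b} x) (zero {a, c} x)"
proof -
  let ?p = "x(a := 0, b := x b - 1)" and ?q = "x(a := 0, c := x c - 1)"
  have V: "a \<in> V" "a \<noteq> b" "a \<noteq> c" using e edge_neq by auto
  have 0: "?p a = 0" "?q a = 0" using V by auto
  have "near (zero_moves x) ?p ?q"
    unfolding near_def zero_moves_def
  proof (intro conjI CollectI)
    show "move E x ?p" "move E x ?q" using move_pair e x by auto
    show "\<exists>v\<in>V. ?p v = 0" "\<exists>v\<in>V. ?q v = 0" using V(1) 0 by blast+
    show "ht ?p \<le> Suc (ht ?q)" using V by (intro height_step[of c]) auto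
    show "ht ?q \<le> Suc (ht ?p)" using V by (intro height_step[of b]) auto
  qed
  moreover have "chain (zero_moves x) ?p (zero {a, b} x)" "chain (zero_moves x) ?q (zero {a, c} x)"
    by (rule chain_to_zero[OF e(1)]; use x V 0 in force)
      (rule chain_to_zero[OF e(2)]; use x V 0 in force)
  ultimately show ?thesis
    by (meson chain_sym converse_rtranclp_into_rtranclp rtranclp_trans)
qed

lemma chain_meeting_edges:
  assumes "e \<in> E" "f \<in> E" "e \<inter> f \<noteq> {}" "\<forall>v\<in>e \<union> f. 0 < x v"
  shows "chain (zero_moves x) (zero e x) (zero f x)"
proof -
  obtain a where a: "a \<in> e" "a \<in> f" using assms(3) by blast
  obtain b where b: "e = {a, b}" using edge_other_endpoint[OF assms(1) a(1)] .
  obtain c where c: "f = {a, c}" using edge_other_endpoint[OF assms(2) a(2)] .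
  show ?thesis using assms unfolding b c by (intro chain_adjacent_edges) auto
qed

text \<open>For disjoint edges a linking edge \<open>g\<close> serves as an intermediate stop; it
  can be played at \<open>x\<close> because it lies in the union of \<open>e\<close> and
  \<open>f\<close>.\<close>

lemma chain_edges:
  assumes "e \<in> E" "f \<in> E" "\<forall>v\<in>e \<union> f. 0 < x v"
  shows "chain (zero_moves x) (zero e x) (zero f x)"
proof (cases "e \<inter> f = {}")
  case True
  obtain g where g: "g \<in> E" "g \<subseteq> e \<union> f" "e \<inter> g \<noteq> {}" "f \<inter> g \<noteq> {}"
    using linking_edge[OF assms(1,2) True] by blast
  have "chain (zero_moves x) (zero e x) (zero g x)"
    by (rule chain_meeting_edges) (use assms g in blast)+
  also have "chain (zero_moves x) (zero g x) (zero f x)"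
    by (rule chain_meeting_edges) (use assms g in blast)+
  finally show ?thesis .
next
  case False
  then show ?thesis using assms by (intro chain_meeting_edges)
qed

text \<open>Every such move is joined to the one that empties its edge completely, and
  \<open>chain_edges\<close> joins these.\<close>

lemma chain_zero_moves:
  assumes "p \<in> zero_moves x" "q \<in> zero_moves x"
  shows "chain (zero_moves x) p q"
proof -
  have *: "\<exists>e\<in>E. (\<forall>v\<in>e. 0 < x v) \<and> chain (zero_moves x) r (zero e x)" if "r \<in> zero_moves x" for r
  proof -
    obtain e where e: "e \<in> E" "\<forall>v\<in>e. r v < x v" "\<forall>v. v \<notin> e \<longrightarrow> r v = x v" "\<exists>v\<in>V. r v = 0"
      using \<open>r \<in> zero_moves x\<close> unfolding zero_moves_def move_def by blast
    obtain a b where ab: "e = {a, b}" "a \<noteq> b" using edge_endpoints[OF e(1)] .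
    have r: "r = x(a := r a, b := r b)" using e(3) ab by auto
    have "chain (zero_moves x) (x(a := r a, b := r b)) (zero {a, b} x)"
      using e ab r by (intro chain_to_zero) auto
    then show ?thesis using r e(1,2) ab by (metis gr_zeroI not_less_zero)
  qed
  obtain e where "e \<in> E" "\<forall>v\<in>e. 0 < x v" "chain (zero_moves x) p (zero e x)"
    using *[OF assms(1)] by blast
  moreover obtain f where "f \<in> E" "\<forall>v\<in>f. 0 < x v" "chain (zero_moves x) q (zero f x)"
    using *[OF assms(2)] by blast
  ultimately show ?thesis using chain_edges[of e f x] chain_sym rtranclp_trans
    by (metis (no_types, lifting) UnE)
qed

text \<open>Among the edges formed by nonempty piles other than \<open>c\<close>, empty one that
  meets all of them. Every edge still playable then contains \<open>c\<close>, so the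
  \<open>d\<close> stones on \<open>c\<close> bound the height.\<close>

lemma low_zero_move:
  assumes c: "c \<in> V" "x c = d" "\<And>v. v \<in> V \<Longrightarrow> d \<le> x v" and pos: "0 < d \<or> 0 < ht x"
  shows "\<exists>p\<in>zero_moves x. ht p \<le> d"
proof -
  let ?S = "{v \<in> V. v \<noteq> c \<and> 0 < x v}"
  have "\<exists>e\<in>E. e \<subseteq> ?S"
  proof (cases "d = 0")
    case True
    then obtain e where e: "e \<in> E" "\<forall>v\<in>e. 0 < x v"
      using height_dec_exists pos by (metis less_irrefl)
    then have "e \<subseteq> ?S" using c(2) True by fastforce
    then show ?thesis using e(1) by blast
  next
    case False
    obtain e f where "e \<in> E" "c \<in> e" "f \<in> E" "e \<inter> f = {}" using c(1) disjoint_edge by blast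
    then have "f \<in> E" "f \<subseteq> ?S" using c(3) False by fastforce+
    then show ?thesis by blast
  qed
  moreover have "?S \<subset> V" using c(1) by blast
  ultimately have "\<exists>e\<in>E. e \<subseteq> ?S \<and> (\<forall>f\<in>E. f \<subseteq> ?S \<longrightarrow> e \<inter> f \<noteq> {})"
    by (intro transversal_edge)
  then obtain e where e: "e \<in> E" "e \<subseteq> ?S" "\<forall>f\<in>E. f \<subseteq> ?S \<longrightarrow> e \<inter> f \<noteq> {}"
    by (elim bexE conjE)
  have "ht (zero e x) \<le> sum (zero e x) {c}"
  proof (rule height_le_cover)
    fix f assume f: "f \<in> E" "\<forall>v\<in>f. 0 < zero e x v"
    then have "e \<inter> f = {}" "\<forall>v\<in>f. 0 < x v" by (auto simp: zero_def split: if_splits)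
    then have "\<not> f \<subseteq> ?S" using e(3) f(1) by blast
    then show "f \<inter> {c} \<noteq> {}" using f(1) \<open>\<forall>v\<in>f. 0 < x v\<close> by blast
  qed simp
  also have "\<dots> \<le> d" using c(2) by (simp add: zero_def)
  finally show ?thesis using zero_in_zero_moves[OF e(1)] e(2) by blast
qed

text \<open>All heights between that of a low move and that of a high one are attained. The case
  \<open>d = 0\<close> and \<open>k = ht x\<close> is excluded because a move lowers the
  height.\<close>

lemma zero_move_of_height:
  assumes c: "c \<in> V" "x c = d" "\<And>v. v \<in> V \<Longrightarrow> d \<le> x v"
    and k: "d \<le> k" "k \<le> ht (\<lambda>v. x v - d)" "\<not> (d = 0 \<and> k = ht x)"
  shows "\<exists>r\<in>zero_moves x. ht r = k"
proof -
  have "0 < d \<or> 0 < ht x" using k by (cases "d = 0") auto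
  then obtain p where p: "p \<in> zero_moves x" "ht p \<le> d" using low_zero_move[of c x d, OF c] by blast
  have "\<exists>q\<in>zero_moves x. k \<le> ht q"
  proof (cases "d = 0")
    case True
    then have "0 < ht x" using k by simp
    then obtain e where e: "e \<in> E" "move E x (dec e x)" "ht x = Suc (ht (dec e x))"
      using height_dec_exists by blast
    moreover have "dec e x c = 0" using c(2) True by (simp add: dec_def)
    ultimately show ?thesis using k True c(1) unfolding zero_moves_def by fastforce
  next
    case False
    obtain a where a: "{c, a} \<in> E" using incident_edge[OF c(1)] .
    then have ac: "a \<noteq> c" "a \<in> V" using edge_neq by auto
    \<comment> \<open>Taking all \<open>d\<close> stones from \<open>c\<close> and one from a
      neighbour leaves at least \<open>x v - d\<close> stones in every pile, because
      \<open>d\<close> is positive.\<close>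
    let ?q = "x(c := 0, a := x a - 1)"
    have "move E x ?q" using c(2) c(3)[OF ac(2)] False by (intro move_pair a) auto
    moreover have "?q c = 0" using ac by simp
    ultimately have "?q \<in> zero_moves x" using c(1) unfolding zero_moves_def by blast
    moreover have "ht (\<lambda>v. x v - d) \<le> ht ?q"
      using False c(2) by (intro height_mono) auto
    ultimately show ?thesis using k(2) le_trans by blast
  qed
  then obtain q where q: "q \<in> zero_moves x" "k \<le> ht q" by blast
  show ?thesis
    using chain_intermediate[OF chain_zero_moves[OF p(1) q(1)] p(1)] p(2) q(2) k(1) by simp
qed

section \<open>Moves to every smaller value\<close>

lemma move_to_min_and_y:
  assumes d: "d \<le> mp x" "d \<le> k" and k: "k < yf x" "\<not> (d = 0 \<and> Suc k = yf x)"
  shows "\<exists>x'. move E x x' \<and> mp x' = mp x - d \<and> yf x' = Suc k"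
proof -
  let ?n = "mp x - d"
  \<comment> \<open>The position \<open>?u\<close> has minimum \<open>d\<close>. A move from it to
    an empty pile and height \<open>k\<close>, raised by \<open>?n\<close> everywhere, leads to
    minimum \<open>?n\<close> and y equal to \<open>Suc k\<close>.\<close>
  let ?u = "\<lambda>v. x v - ?n"
  obtain c where c: "c \<in> V" "x c = mp x" using min_pile_attained by blast
  have y: "yf x = Suc (ht (\<lambda>v. ?u v - d))" using d(1) by (simp add: y_fun_eq)
  have ge: "?n \<le> x v" if "v \<in> V" for v using min_pile_le[OF that, of x] by simp
  have "\<exists>r\<in>zero_moves ?u. ht r = k"
  proof (rule zero_move_of_height)
    show "c \<in> V" "?u c = d" using c d(1) by auto
    show "d \<le> ?u v" if "v \<in> V" for v using min_pile_le[OF that, of x] d(1) by simp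
    show "\<not> (d = 0 \<and> k = ht ?u)" using k(2) y by auto
  qed (use d k y in auto)
  then obtain r where r: "move E ?u r" "ht r = k" and r0: "\<exists>w\<in>V. r w = 0"
    unfolding zero_moves_def by blast
  obtain h where h: "h \<in> E" "\<forall>i\<in>h. r i < ?u i" "\<forall>i. i \<notin> h \<longrightarrow> r i = ?u i"
    using r(1) unfolding move_def by blast
  define x' where "x' v = (if v \<in> V then r v + ?n else x v)" for v
  have "move E x x'"
    unfolding move_def
  proof (intro bexI[OF _ h(1)] conjI ballI allI impI)
    fix i assume "i \<in> h"
    then have "r i < x i - ?n" "i \<in> V" using h(1,2) by auto
    then show "x' i < x i" by (simp add: x'_def less_diff_conv)
  next
    fix i assume "i \<notin> h"
    then show "x' i = x i" using h(3) ge[of i] by (simp add: x'_def)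
  qed
  moreover have m': "mp x' = ?n"
  proof -
    obtain w where "w \<in> V" "r w = 0" using r0 by blast
    then show ?thesis by (intro min_pile_eqI[of w]) (auto simp: x'_def)
  qed
  moreover have "ht (\<lambda>v. x' v - ?n) = ht r" by (rule height_cong) (simp add: x'_def)
  then have "yf x' = Suc k" using m' r(2) by (simp add: y_fun_eq)
  ultimately show ?thesis by blast
qed

text \<open>The blocks from \<open>n choose 2\<close> up to \<open>Suc n choose 2\<close> follow one
  another without gaps. The \<open>n\<close> found here is the y of every long position of value
  \<open>z\<close>.\<close>

lemma ex_choose_two_interval: "\<exists>n\<ge>1. n choose 2 \<le> z \<and> z < Suc n choose 2"
proof (induction z)
  case 0
  show ?case by (intro exI[of _ 1]) (simp add: numeral_2_eq_2)
next
  case (Suc z)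
  then obtain n where n: "1 \<le> n" "n choose 2 \<le> z" "z < Suc n choose 2" by blast
  show ?case
  proof (cases "Suc z < Suc n choose 2")
    case True
    then show ?thesis using n by (intro exI[of _ n]) simp
  next
    case False
    then show ?thesis using n choose_two_Suc[of "Suc n"] by (intro exI[of _ "Suc n"]) simp
  qed
qed

text \<open>A value below the minimum is reached at a long position: its y is the \<open>n\<close>
  whose block contains \<open>z\<close>, and its minimum is chosen in the right residue class modulo
  \<open>n\<close>.\<close>

lemma move_to_small_value:
  assumes z: "z < mp x" "z < ff x"
  shows "\<exists>x'. move E x x' \<and> ff x' = z"
proof -
  obtain n where n: "1 \<le> n" "n choose 2 \<le> z" "z < Suc n choose 2"
    using ex_choose_two_interval by blast
  \<comment> \<open>This drop makes the new minimum congruent to \<open>z + 1\<close> modulo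
    \<open>n\<close>, and it is less than \<open>n\<close>, as \<open>move_to_min_and_y\<close>
    requires.\<close>
  define d where "d = (mp x - 1 - z) mod n"
  have d: "d < n" "d \<le> mp x - 1 - z" using n(1) by (auto simp: d_def)
  define q where "q = (mp x - 1 - z) div n"
  have q: "mp x - 1 - z = n * q + d" by (simp add: d_def q_def)
  \<comment> \<open>If \<open>x\<close> is long, keeping both y and the minimum would mean that
    \<open>x\<close> itself has value \<open>z\<close>. Otherwise \<open>n\<close> is smaller than
    y, because \<open>n choose 2\<close> is below the minimum.\<close>
  have "n \<le> yf x \<and> \<not> (d = 0 \<and> n = yf x)"
  proof (cases "yf x choose 2 < mp x")
    case True
    have "z < Suc (yf x) choose 2" using z(2) f_fun_long_bounds(2)[OF True] by simp
    then have "n \<le> yf x" using n(2) choose_two_mono[of "Suc (yf x)" n] by (meson leD le_trans not_less_eq_eq)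
    moreover have False if "d = 0" "n = yf x"
    proof -
      have "mp x - (n choose 2) - 1 = (z - (n choose 2)) + n * q"
        using q that(1) n(2) z(1) by simp
      moreover have "z - (n choose 2) < n" using n(2,3) unfolding choose_two_Suc by linarith
      ultimately have "(mp x - (n choose 2) - 1) mod n = z - (n choose 2)" by simp
      then have "ff x = z" using f_fun_long[OF True] that(2) n(2) by simp
      then show False using z(2) by simp
    qed
    ultimately show ?thesis by blast
  next
    case False
    then have "n choose 2 < yf x choose 2" using n(2) z(1) by simp
    then show ?thesis using choose_two_mono[of "yf x" n] by (meson leD leI le_less_linear less_or_eq_imp_le order.strict_iff_order)
  qed
  then have "\<exists>x'. move E x x' \<and> mp x' = mp x - d \<and> yf x' = Suc (n - 1)"
    using d z(1) n(1) by (intro move_to_min_and_y) auto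
  then obtain x' where x': "move E x x'" "mp x' = mp x - d" "yf x' = n" using n(1) by auto
  \<comment> \<open>The new minimum still exceeds \<open>z\<close>, which is at least
    \<open>n choose 2\<close>.\<close>
  have long: "yf x' choose 2 < mp x'" using x' d(2) z(1) n(2) by simp
  have "mp x' - (n choose 2) - 1 = (z - (n choose 2)) + n * q"
    using q x'(2) n(2) z(1) by simp
  moreover have "z - (n choose 2) < n" using n(2,3) unfolding choose_two_Suc by linarith
  ultimately have "(mp x' - (n choose 2) - 1) mod n = z - (n choose 2)" by simp
  then have "ff x' = z" using f_fun_long[OF long] x'(3) n(2) by simp
  then show ?thesis using x'(1) by blast
qed

text \<open>Exchange argument: a maximum packing that avoids \<open>a\<close> stays maximum after one of its edges
  at a neighbour \<open>b\<close> is replaced by \<open>ab\<close>.\<close>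

lemma max_move_through_vertex:
  assumes a: "a \<in> V" and pos: "\<And>v. v \<in> V \<Longrightarrow> 0 < x v"
  obtains b where "{a, b} \<in> E" "ht x \<le> Suc (ht (dec {a, b} x))"
proof -
  obtain M where M: "packing E x M" "size M = ht x" using max_packing .
  obtain b where b: "{a, b} \<in> E" using incident_edge[OF a] .
  have ab: "a \<noteq> b" "b \<in> V" using edge_neq[OF b] b by auto
  have main: thesis if "packing E (dec {a, b} x) N" "ht x \<le> Suc (size N)" for N
    using that b packing_le_height[OF that(1)] \<open>\<And>b. _ \<Longrightarrow> _ \<Longrightarrow> thesis\<close> by (meson Suc_le_mono le_trans)
  show thesis
  proof (cases "load M a = 0")
    case a0: True
    show thesis
    proof (cases "load M b = 0")
      case True
      have "packing E (dec {a, b} x) M"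
        using M(1) a0 True by (auto simp: packing_def dec_def)
      then show thesis using main M(2) by simp
    next
      case False
      then obtain f N where f: "b \<in> f" "M = add_mset f N"
        by (metis gr0I load_posD multi_member_split)
      have "packing E (dec {a, b} x) N"
        unfolding packing_def
      proof (intro conjI allI)
        show "set_mset N \<subseteq> E" using M(1) f by (simp add: packing_def)
        fix v
        have "load M v \<le> x v" using M(1) by (simp add: packing_def)
        then show "load N v \<le> dec {a, b} x v"
          using a0 f by (auto simp: dec_def split: if_splits)
      qed
      then show thesis using main M(2) f(2) by simp
    qed
  next
    case False
    then obtain f N where f: "a \<in> f" "M = add_mset f N"
      by (metis gr0I load_posD multi_member_split)
    have "f \<in> E" using M(1) f(2) by (simp add: packing_def)
    then obtain c where c: "f = {a, c}" using edge_other_endpoint f(1) by blast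
    have "size N \<le> ht (dec f x)" using packing_dec(2) packing_le_height M(1) f(2) by blast
    then show thesis
      using that[of c] \<open>f \<in> E\<close> M(2) f(2) unfolding c by simp
  qed
qed

text \<open>Among the followers whose value is their height there is one of height at most
  \<open>mp x\<close> and one of height at least \<open>z\<close>. A chain between them that stays
  within these followers attains \<open>z\<close>.\<close>

lemma move_to_large_value:
  assumes short: "mp x \<le> yf x choose 2" and z: "mp x \<le> z" "z < ht x"
  shows "\<exists>x'. move E x x' \<and> ht x' = z \<and> mp x' \<le> yf x' choose 2"
proof -
  define X where "X = {x'. move E x x' \<and> mp x' \<le> yf x' choose 2}"
  obtain a where a: "a \<in> V" "x a = mp x" using min_pile_attained by blast
  have zX: "zero_moves x \<subseteq> X"
  proof
    fix r assume "r \<in> zero_moves x"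
    then obtain w where "move E x r" "w \<in> V" "r w = 0" unfolding zero_moves_def by blast
    moreover from this have "mp r = 0" by (intro min_pile_eqI[of w]) auto
    ultimately show "r \<in> X" by (simp add: X_def)
  qed
  have "\<exists>p\<in>zero_moves x. ht p \<le> mp x"
    using a z min_pile_le by (intro low_zero_move[of a]) auto
  then obtain p where p: "p \<in> zero_moves x" "ht p \<le> mp x" by blast
  have "\<exists>q. chain X p q \<and> z \<le> ht q"
  proof (cases "mp x = 0")
    case True
    obtain e where e: "e \<in> E" "move E x (dec e x)" "ht x = Suc (ht (dec e x))"
      using height_dec_exists z(2) by (metis less_nat_zero_code gr0I)
    have "dec e x a = 0" using a True by (simp add: dec_def)
    then have "dec e x \<in> zero_moves x" using e(2) a(1) unfolding zero_moves_def by blast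
    then have "chain X p (dec e x)" using chain_subset[OF chain_zero_moves[OF p(1)] zX] by blast
    then show ?thesis using e(3) z(2) by (metis less_Suc_eq_le)
  next
    case False
    then have pos: "0 < x v" if "v \<in> V" for v using min_pile_le[OF that, of x] by simp
    obtain b where b: "{a, b} \<in> E" "ht x \<le> Suc (ht (dec {a, b} x))"
      using max_move_through_vertex[OF a(1)] pos by blast
    have ab: "a \<noteq> b" "b \<in> V" using edge_neq[OF b(1)] b(1) by auto
    \<comment> \<open>The chain from the follower \<open>dec {a, b} x\<close> to a zero move lowers
      the smallest pile \<open>a\<close> stone by stone, with one stone taken from \<open>b\<close>
      throughout.\<close>
    let ?w = "x(b := x b - 1)"
    have wX: "?w(a := i) \<in> X" if i: "i < mp x" for i
    proof -
      have w: "?w(a := i) = x(a := i, b := x b - 1)" using ab(1) by (rule fun_upd_twist[OF not_sym])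
      have mv: "move E x (?w(a := i))"
        unfolding w using i a(2) pos[OF ab(2)] by (intro move_pair b(1)) auto
      have m: "mp (?w(a := i)) = i"
      proof (rule min_pile_eqI[OF a(1)])
        show "i \<le> (?w(a := i)) v" if "v \<in> V" for v using i min_pile_le[OF that, of x] by auto
      qed simp
      \<comment> \<open>The minimum sinks to \<open>i\<close> together with \<open>a\<close>. This
        drop makes up for the stone taken from \<open>b\<close>, so y does not fall and the follower
        does not become long.\<close>
      have "ht (\<lambda>v. x v - mp x) \<le> ht (\<lambda>v. (?w(a := i)) v - i)"
        using i a(2) by (intro height_mono) auto
      then have "yf x \<le> yf (?w(a := i))" using m by (simp add: y_fun_eq)
      then have "yf x choose 2 \<le> yf (?w(a := i)) choose 2" by (rule choose_two_mono)
      then have "mp (?w(a := i)) \<le> yf (?w(a := i)) choose 2" using m i short by simp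
      then show ?thesis using mv by (simp add: X_def)
    qed
    have "?w(a := 0) \<in> zero_moves x"
      using wX[of 0] False a(1) unfolding X_def zero_moves_def by fastforce
    then have "chain X p (?w(a := 0))" using chain_subset[OF chain_zero_moves[OF p(1)] zX] by blast
    moreover have "chain X (?w(a := mp x - 1)) (?w(a := 0))"
      using wX False by (intro chain_line) simp
    moreover have "?w(a := mp x - 1) = dec {a, b} x"
      using a(2) by (auto simp: dec_def)
    ultimately have "chain X p (dec {a, b} x)" by (metis chain_sym rtranclp_trans)
    then show ?thesis using b(2) z(2) by (meson Suc_le_mono Suc_leI le_trans)
  qed
  then obtain q where q: "chain X p q" "z \<le> ht q" by blast
  have "\<exists>r\<in>X. ht r = z"
    by (rule chain_intermediate[OF q(1)]) (use p zX z(1) q(2) in auto)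
  then show ?thesis unfolding X_def by blast
qed

lemma move_to_smaller_value:
  assumes "z < ff x"
  shows "\<exists>x'. move E x x' \<and> ff x' = z"
proof (cases "z < mp x")
  case True
  then show ?thesis using assms by (rule move_to_small_value)
next
  case False
  have short: "mp x \<le> yf x choose 2"
    using f_fun_long_bounds(3)[of x] assms False by force
  then have "z < ht x" using assms by (simp add: f_fun_def)
  then obtain x' where "move E x x'" "ht x' = z" "mp x' \<le> yf x' choose 2"
    using move_to_large_value[OF short, of z] False by auto
  then show ?thesis by (auto simp: f_fun_def)
qed

lemma sprague_grundy_eq: "sprague_grundy E x = ff x"
proof (induction x rule: wf_induct_rule[OF wf_move[OF hyp]])
  case (1 x)
  have "sprague_grundy E x' = ff x'" if "move E x x'" for x'
    by (rule 1) (use that in simp)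
  then have "{sprague_grundy E x' | x'. move E x x'} = {ff x' | x'. move E x x'}"
    by metis
  then have "sprague_grundy E x = mex {ff x' | x'. move E x x'}"
    using sprague_grundy_unfold[OF hyp, of x] by simp
  also have "\<dots> = ff x"
    unfolding mex_def
  proof (rule Least_equality)
    show "ff x \<notin> {ff x' | x'. move E x x'}" using f_fun_move_neq by fastforce
    show "ff x \<le> y" if "y \<notin> {ff x' | x'. move E x x'}" for y
      using that move_to_smaller_value[of y x] by (force simp: not_le[symmetric])
  qed
  finally show ?case .
qed

lemma JM: "JM E"
  using hyp sprague_grundy_eq by (simp add: JM_def)

end

section \<open>Necessity\<close>

context finite_hypergraph
begin

lemma JM_move_to:
  assumes "JM H" "x \<in> positions H" "z < ff x"
  obtains x' where "move H x x'" "ff x' = z"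
proof -
  let ?S = "{sprague_grundy H x' | x'. move H x x'}"
  have "z < mex ?S"
    using assms sprague_grundy_unfold[OF hyp, of x] by (simp add: JM_def)
  then have "z \<in> ?S" unfolding mex_def using not_less_Least by blast
  then show thesis using that assms(1,2) move_in_positions unfolding JM_def by fastforce
qed

lemma JM_move_neq:
  assumes "JM H" "x \<in> positions H" "move H x x'"
  shows "ff x' \<noteq> ff x"
proof -
  let ?S = "{sprague_grundy H x' | x'. move H x x'}"
  \<comment> \<open>There are finitely many followers, so some value is missing and the
    \<open>LEAST\<close> in \<open>mex\<close> is attained.\<close>
  have "{x'. move H x x'} \<subseteq> (\<Pi>\<^sub>E v\<in>V. {..x v})"
  proof
    fix z assume "z \<in> {x'. move H x x'}"
    then have z: "move H x z" by simp
    then have "z \<in> V \<rightarrow>\<^sub>E UNIV" using move_in_positions[OF assms(2)] by (simp add: positions_def)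
    moreover have "z v \<le> x v" for v using z unfolding move_def by (metis less_imp_le order_refl)
    ultimately show "z \<in> (\<Pi>\<^sub>E v\<in>V. {..x v})" by (simp add: PiE_iff)
  qed
  then have "finite {x'. move H x x'}"
    using finite_V by (rule finite_subset[OF _ finite_PiE]) auto
  then have "finite ?S" by simp
  then have "\<exists>n. n \<notin> ?S" using ex_new_if_finite infinite_UNIV_nat by blast
  then have "mex ?S \<notin> ?S" unfolding mex_def by (rule LeastI_ex)
  then have "sprague_grundy H x \<notin> ?S" by (simp add: sprague_grundy_unfold[OF hyp, of x])
  moreover have "sprague_grundy H x' \<in> ?S" using assms(3) by blast
  ultimately have "sprague_grundy H x' \<noteq> sprague_grundy H x" by metis
  then show ?thesis using assms move_in_positions[OF assms(2,3)] by (simp add: JM_def)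
qed

lemma f_fun_min_1_y_1: "mp x = 1 \<Longrightarrow> yf x = 1 \<Longrightarrow> ff x = 0"
  by (simp add: f_fun_def v_fun_def numeral_2_eq_2)

lemma height_eq_0: "(\<And>e. e \<in> H \<Longrightarrow> \<exists>v\<in>e. x v = 0) \<Longrightarrow> ht x = 0"
  using height_le_cover[of "{}" x] by fastforce

text \<open>The position with one stone everywhere has minimum and y equal to 1, hence value 0. If
  every edge met \<open>e\<close>, emptying \<open>e\<close> would lead to height 0, again of value
  0.\<close>

lemma JM_disjoint_edge:
  assumes JM: "JM H" and e: "e \<in> H"
  shows "\<exists>f\<in>H. e \<inter> f = {}"
proof (rule ccontr)
  assume no: "\<not> (\<exists>f\<in>H. e \<inter> f = {})"
  let ?x = "\<lambda>v\<in>V. 1 :: nat" and ?x' = "\<lambda>v\<in>V. if v \<in> e then 0 else 1 :: nat"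
  obtain w where w: "w \<in> e" using hyp e unfolding hypergraph_def by (metis ex_in_conv)
  have wV: "w \<in> V" using w e by blast
  have m: "mp ?x = 1" by (rule min_pile_eqI[OF wV]) (use wV in auto)
  have "ht (\<lambda>v. ?x v - 1) = 0"
  proof (rule height_eq_0)
    fix f assume "f \<in> H"
    moreover then obtain u where "u \<in> f" using hyp unfolding hypergraph_def by (metis ex_in_conv)
    ultimately show "\<exists>v\<in>f. ?x v - 1 = 0" by (intro bexI[of _ u]) auto
  qed
  then have "ff ?x = 0" using m by (intro f_fun_min_1_y_1) (simp_all add: y_fun_eq)
  moreover have "ff ?x' = 0"
  proof -
    have "mp ?x' = 0" by (rule min_pile_eqI[OF wV]) (use w wV in auto)
    moreover have "ht ?x' = 0"
    proof (rule height_eq_0)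
      fix f assume "f \<in> H"
      moreover then obtain u where "u \<in> e" "u \<in> f" using no by blast
      ultimately show "\<exists>v\<in>f. ?x' v = 0" by (intro bexI[of _ u]) auto
    qed
    ultimately show ?thesis by (simp add: f_fun_min_0)
  qed
  moreover have "move H ?x ?x'"
    unfolding move_def using e by (intro bexI[OF _ e]) auto
  moreover have "?x \<in> positions H" by (simp add: positions_def)
  ultimately show False using JM_move_neq[OF JM, of ?x ?x'] by simp
qed

text \<open>The indicator of \<open>S\<close> has an empty pile, so its value is its height, which
  is positive. A move to value 0 must leave nothing playable, so its hyperedge meets all those
  inside \<open>S\<close>.\<close>

lemma JM_transversal_edge:
  assumes JM: "JM H" and S: "S \<subset> V" and ex: "\<exists>e\<in>H. e \<subseteq> S"
  shows "\<exists>e\<in>H. e \<subseteq> S \<and> (\<forall>f\<in>H. f \<subseteq> S \<longrightarrow> e \<inter> f \<noteq> {})"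
proof (rule ccontr)
  assume "\<not> ?thesis"
  then have no: "\<exists>f\<in>H. f \<subseteq> S \<and> e \<inter> f = {}" if "e \<in> H" "e \<subseteq> S" for e
    using that by meson
  let ?x = "\<lambda>v\<in>V. if v \<in> S then 1 else 0 :: nat"
  obtain w where w: "w \<in> V" "w \<notin> S" using S by blast
  have min0: "mp z = 0" if "z w = 0" for z by (rule min_pile_eqI[OF w(1)]) (use that in auto)
  obtain e where "e \<in> H" "e \<subseteq> S" using ex by blast
  then have "1 \<le> ht ?x" by (intro height_edge) auto
  then have "0 < ff ?x" using min0[of ?x] w by (simp add: f_fun_min_0)
  moreover have "?x \<in> positions H" by (simp add: positions_def)
  ultimately obtain x' where x': "move H ?x x'" "ff x' = 0" using JM_move_to[OF JM, of ?x 0] by blast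
  obtain h where h: "h \<in> H" "\<forall>i\<in>h. x' i < ?x i" "\<forall>i. i \<notin> h \<longrightarrow> x' i = ?x i"
    using x'(1) unfolding move_def by blast
  have "h \<subseteq> S"
  proof
    fix i assume "i \<in> h"
    then have "i \<in> V" "x' i < ?x i" using h(1,2) by blast+
    then show "i \<in> S" by (simp split: if_splits)
  qed
  then obtain f where f: "f \<in> H" "f \<subseteq> S" "h \<inter> f = {}" using no h(1) by blast
  have "1 \<le> ht x'"
  proof (rule height_edge[OF f(1)])
    fix v assume "v \<in> f"
    then have "v \<notin> h" "v \<in> S" "v \<in> V" using f by blast+
    then show "1 \<le> x' v" using h(3) by simp
  qed
  moreover have "x' w = ?x w" using h(3) w \<open>h \<subseteq> S\<close> by blast
  then have "x' w = 0" using w by simp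
  ultimately show False using x'(2) min0 f_fun_min_0 by simp
qed

text \<open>On two disjoint edges the position with piles 1, 1 and 3, 3 has no follower of value 2.\<close>

lemma two_disjoint_edges_not_JM:
  assumes ef: "H = {e, f}" "e \<inter> f = {}" "card e = 2" "card f = 2"
  shows "\<not> JM H"
proof
  assume JM: "JM H"
  obtain a b where ab: "e = {a, b}" "a \<noteq> b" using ef(3) by (auto simp: card_2_iff)
  let ?x = "\<lambda>v\<in>V. if v \<in> e then 1 else 3 :: nat"
  have V: "V = e \<union> f" "a \<in> V" "b \<in> V" using ef ab by auto
  have two: "2 * k + ht (\<lambda>v. z v - k) \<le> ht z" if "\<forall>v\<in>V. k \<le> z v" for k z
    using that height_two_edges[of e f k z] ef by auto
  have mx: "mp ?x = 1" by (rule min_pile_eqI[OF V(2)]) (use ab V in auto)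
  have "2 \<le> ht (\<lambda>v. ?x v - 1)"
    by (rule height_edge[of f]) (use ef V in auto)
  \<comment> \<open>Since \<open>2 choose 2\<close> equals the minimum 1, the value of
    \<open>?x\<close> is its height, which is at least 4.\<close>
  moreover from this have "2 choose 2 \<le> yf ?x choose 2"
    using mx by (intro choose_two_mono) (simp add: y_fun_eq)
  moreover have "2 * 1 + ht (\<lambda>v. ?x v - 1) \<le> ht ?x" by (rule two) auto
  ultimately have "2 < ff ?x" using mx by (simp add: f_fun_def)
  moreover have "?x \<in> positions H" by (simp add: positions_def)
  ultimately obtain x' where x': "move H ?x x'" "ff x' = 2" using JM_move_to[OF JM, of ?x 2] by blast
  obtain h where h: "h \<in> H" "\<forall>i\<in>h. x' i < ?x i" "\<forall>i. i \<notin> h \<longrightarrow> x' i = ?x i"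
    using x'(1) unfolding move_def by blast
  have min0: "ff x' = ht x'" if "w \<in> V" "x' w = 0" for w
    using that min_pile_eqI[of w x' 0] by (simp add: f_fun_min_0)
  \<comment> \<open>A move on \<open>e\<close> empties \<open>e\<close> and leaves height at least
    3. A move on \<open>f\<close> leaves an empty pile and value at most 1, or a smallest pile 1 in
    \<open>f\<close> and value 0, or two piles of 2 and value at least 3.\<close>
  show False
  proof (cases "h = e")
    case True
    have "x' a < ?x a" using h(2) True ab by blast
    then have "x' a = 0" using ab V(2) by simp
    moreover have "3 \<le> ht x'"
    proof (rule height_edge[of f])
      show "3 \<le> x' v" if "v \<in> f" for v
        using that h(3) True ef(2) V(1) by (auto simp: disjoint_iff)
    qed (use ef in simp)
    ultimately show False using min0[OF V(2)] x'(2) by simp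
  next
    case False
    then have hf: "h = f" using h(1) ef(1) by blast
    have on_e: "x' v = 1" if "v \<in> e" for v
      using that h(3) hf ef(2) V(1) by (auto simp: disjoint_iff)
    have on_f: "x' v < 3" if "v \<in> f" for v
    proof -
      have "v \<notin> e" "v \<in> V" using that ef(2) V(1) by blast+
      moreover have "x' v < ?x v" using that h(2) hf by blast
      ultimately show ?thesis by simp
    qed
    have "x' v = 0 \<or> x' v = 1 \<or> x' v = 2" if "v \<in> f" for v using on_f[OF that] by linarith
    then consider c where "c \<in> f" "x' c = 0" | c where "c \<in> f" "x' c = 1" "\<forall>v\<in>f. x' v \<noteq> 0"
      | "\<forall>v\<in>f. x' v = 2"
      by blast
    then show False
    proof cases
      case 1
      have "ht x' \<le> sum x' {a, c}"
        by (rule height_le_cover) (use ef(1) ab 1 in auto)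
      also have "\<dots> \<le> 1" using on_e[of a] 1(2) ab by (cases "a = c") auto
      finally show False using min0[of c] 1 V x'(2) by auto
    next
      case 2
      have ge: "1 \<le> x' v" if "v \<in> V" for v
        using that on_e[of v] 2(3) V(1) by (cases "v \<in> e") (auto simp: Suc_le_eq)
      have m: "mp x' = 1"
      proof (rule min_pile_eqI[OF V(2)])
        show "x' a = 1" using on_e[of a] ab by simp
      qed (rule ge)
      have "ht (\<lambda>v. x' v - 1) = 0"
      proof (rule height_eq_0)
        fix g assume "g \<in> H"
        then have "a \<in> g \<or> c \<in> g" using ef(1) ab(1) 2(1) by blast
        moreover have "x' a - 1 = 0" "x' c - 1 = 0" using on_e[of a] ab(1) 2(2) by simp_all
        ultimately show "\<exists>v\<in>g. x' v - 1 = 0" by blast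
      qed
      then have "ff x' = 0" using m by (intro f_fun_min_1_y_1) (simp_all add: y_fun_eq)
      then show False using x'(2) by simp
    next
      case 3
      have ge: "1 \<le> x' v" if "v \<in> V" for v
        using that on_e[of v] 3 V(1) by (cases "v \<in> e") auto
      have m: "mp x' = 1"
      proof (rule min_pile_eqI[OF V(2)])
        show "x' a = 1" using on_e[of a] ab by simp
      qed (rule ge)
      have h1: "1 \<le> ht (\<lambda>v. x' v - 1)"
        by (rule height_edge[of f]) (use ef 3 in auto)
      then have "2 choose 2 \<le> yf x' choose 2"
        using m by (intro choose_two_mono) (simp add: y_fun_eq)
      then have "ff x' = ht x'" using m by (simp add: f_fun_def)
      moreover have "2 * 1 + ht (\<lambda>v. x' v - 1) \<le> ht x'" by (rule two) (use ge in simp)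
      ultimately show False using h1 x'(2) by simp
    qed
  qed
qed

end

text \<open>Only the linking edge needs an argument. If the two edges do not cover all vertices, the
  transversal condition for their union gives an edge meeting both; if they do and no edge links
  them, the graph consists of two disjoint edges.\<close>

lemma JM_imp_critical_graph:
  assumes JM: "JM E" and card: "\<And>e. e \<in> E \<Longrightarrow> card e = 2"
  shows "critical_graph E"
proof -
  interpret finite_hypergraph E using JM by unfold_locales (simp add: JM_def)
  show ?thesis
  proof unfold_locales
    fix e f assume ef: "e \<in> E" "f \<in> E" "e \<inter> f = {}"
    show "\<exists>g\<in>E. g \<subseteq> e \<union> f \<and> e \<inter> g \<noteq> {} \<and> f \<inter> g \<noteq> {}"
    proof (cases "e \<union> f = \<Union>E")
      case True
      have fin: "finite e" "finite f" using card ef by (metis card.infinite zero_neq_numeral)+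
      show ?thesis
      proof (rule ccontr)
        assume no: "\<not> ?thesis"
        have "g = e \<or> g = f" if g: "g \<in> E" for g
        proof -
          have "g \<subseteq> e \<union> f" using g True by blast
          then have "g \<subseteq> e \<or> g \<subseteq> f" using no g by blast
          then show ?thesis using card card_subset_eq fin g ef by metis
        qed
        then have "E = {e, f}" using ef by blast
        then show False using two_disjoint_edges_not_JM ef JM card by blast
      qed
    next
      case False
      then have sub: "e \<union> f \<subset> \<Union>E" using ef by blast
      have ex: "\<exists>g\<in>E. g \<subseteq> e \<union> f" using ef(1) by blast
      obtain g where g: "g \<in> E" "g \<subseteq> e \<union> f"
        and meets: "\<forall>k\<in>E. k \<subseteq> e \<union> f \<longrightarrow> g \<inter> k \<noteq> {}"
        using JM_transversal_edge[OF JM sub ex] by (elim bexE conjE)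
      have "g \<inter> e \<noteq> {}" "g \<inter> f \<noteq> {}" using meets ef(1,2) by auto
      with g show ?thesis by blast
    qed
  next
    show "card e = 2" if "e \<in> E" for e using card that .
    show "\<exists>f\<in>E. e \<inter> f = {}" if "e \<in> E" for e using JM_disjoint_edge[OF JM that] .
    show "\<exists>e\<in>E. e \<subseteq> S \<and> (\<forall>f\<in>E. f \<subseteq> S \<longrightarrow> e \<inter> f \<noteq> {})"
      if "S \<subset> \<Union>E" "\<exists>e\<in>E. e \<subseteq> S" for S
      using JM_transversal_edge[OF JM that] .
  qed
qed

section \<open>The six graphs\<close>

lemma graph_iso_sym:
  assumes "graph_iso G K" "\<forall>e\<in>edges G. e \<subseteq> verts G"
  shows "graph_iso K G"
proof -
  obtain \<phi> where bij: "bij_betw \<phi> (verts G) (verts K)" and im: "(\<lambda>e. \<phi> ` e) ` edges G = edges K"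
    using assms(1) unfolding graph_iso_def by blast
  let ?\<psi> = "inv_into (verts G) \<phi>"
  have "?\<psi> ` \<phi> ` e = e" if "e \<in> edges G" for e
    using bij assms(2) that by (metis bij_betw_imp_inj_on inv_into_image_cancel)
  then have "(\<lambda>e. ?\<psi> ` e) ` edges K = edges G" unfolding im[symmetric] by (force simp: image_image)
  then show ?thesis unfolding graph_iso_def using bij_betw_inv_into[OF bij] by blast
qed

lemma graph_iso_cards:
  assumes "graph_iso G K" "\<forall>e\<in>edges G. e \<subseteq> verts G"
  shows "card (verts G) = card (verts K)" "card (edges G) = card (edges K)"
proof -
  obtain \<phi> where bij: "bij_betw \<phi> (verts G) (verts K)" and im: "(\<lambda>e. \<phi> ` e) ` edges G = edges K"
    using assms(1) unfolding graph_iso_def by blast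
  show "card (verts G) = card (verts K)" using bij by (rule bij_betw_same_card)
  have "inj_on (image \<phi>) (edges G)"
    by (rule inj_on_subset[OF inj_on_image_Pow[OF bij_betw_imp_inj_on[OF bij]]]) (use assms(2) in auto)
  then show "card (edges G) = card (edges K)" unfolding im[symmetric] by (rule card_image[symmetric])
qed

lemma critical_graph_iso:
  assumes G: "simple_graph G" "no_isolated_vertices G" and K: "critical_graph (edges K)"
    and iso: "graph_iso G K"
  shows "critical_graph (edges G)"
proof -
  interpret K: critical_graph "edges K" by (fact K)
  obtain \<phi> where bij: "bij_betw \<phi> (verts G) (verts K)" and im': "(\<lambda>e. \<phi> ` e) ` edges G = edges K"
    using iso unfolding graph_iso_def by blast
  note im = im'[symmetric]
  have V: "\<Union>(edges G) = verts G" using graph_as_hypergraph(1)[OF G] .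
  have inj: "inj_on \<phi> (verts G)" using bij by (rule bij_betw_imp_inj_on)
  have VK: "\<Union>(edges K) = \<phi> ` verts G" unfolding im V[symmetric] by blast
  have sub: "e \<subseteq> verts G" if "e \<in> edges G" for e using that V by blast
  have disj: "\<phi> ` e \<inter> \<phi> ` f = {} \<longleftrightarrow> e \<inter> f = {}" if "e \<in> edges G" "f \<in> edges G" for e f
    using inj_on_image_Int[OF inj sub[OF that(1)] sub[OF that(2)]] by (metis image_is_empty)
  have le: "\<phi> ` e \<subseteq> \<phi> ` S \<longleftrightarrow> e \<subseteq> S" if "e \<in> edges G" "S \<subseteq> verts G" for e S
    using inj_on_image_mem_iff[OF inj _ that(2)] sub[OF that(1)] by fast
  show ?thesis
  proof unfold_locales
    show "hypergraph (edges G)" using graph_as_hypergraph(2)[OF G] .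
    show "card e = 2" if "e \<in> edges G" for e using G(1) that by (simp add: simple_graph_def)
    show "\<exists>f\<in>edges G. e \<inter> f = {}" if "e \<in> edges G" for e
      using K.disjoint_edge[of "\<phi> ` e"] that disj unfolding im by auto
    show "\<exists>g\<in>edges G. g \<subseteq> e \<union> f \<and> e \<inter> g \<noteq> {} \<and> f \<inter> g \<noteq> {}"
      if ef: "e \<in> edges G" "f \<in> edges G" "e \<inter> f = {}" for e f
    proof -
      have "\<phi> ` e \<inter> \<phi> ` f = {}" using disj ef by simp
      then obtain g where g: "g \<in> edges G" "\<phi> ` g \<subseteq> \<phi> ` (e \<union> f)"
          "\<phi> ` e \<inter> \<phi> ` g \<noteq> {}" "\<phi> ` f \<inter> \<phi> ` g \<noteq> {}"
        using K.linking_edge[of "\<phi> ` e" "\<phi> ` f"] ef(1,2) unfolding im image_Un by auto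
      have "g \<subseteq> e \<union> f" using le[OF g(1), of "e \<union> f"] g(2) sub ef by simp
      then show ?thesis using g disj ef(1,2) by metis
    qed
    show "\<exists>e\<in>edges G. e \<subseteq> S \<and> (\<forall>f\<in>edges G. f \<subseteq> S \<longrightarrow> e \<inter> f \<noteq> {})"
      if S: "S \<subset> \<Union>(edges G)" "\<exists>e\<in>edges G. e \<subseteq> S" for S
    proof -
      have SV: "S \<subseteq> verts G" using S(1) V by blast
      have "\<phi> ` S \<subset> \<Union>(edges K)"
        unfolding VK using S(1) V inj by (metis image_strict_mono)
      moreover have "\<exists>e\<in>edges K. e \<subseteq> \<phi> ` S" unfolding im using S(2) by blast
      ultimately have "\<exists>e\<in>edges K. e \<subseteq> \<phi> ` S \<and> (\<forall>f\<in>edges K. f \<subseteq> \<phi> ` S \<longrightarrow> e \<inter> f \<noteq> {})"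
        by (rule K.transversal_edge)
      then obtain e' where e': "e' \<in> edges K" "e' \<subseteq> \<phi> ` S"
        and meets: "\<forall>f\<in>edges K. f \<subseteq> \<phi> ` S \<longrightarrow> e' \<inter> f \<noteq> {}"
        by (elim bexE conjE)
      then obtain e where e: "e \<in> edges G" "e' = \<phi> ` e" unfolding im by (elim imageE)
      have "e \<inter> f \<noteq> {}" if f: "f \<in> edges G" "f \<subseteq> S" for f
      proof -
        have "\<phi> ` f \<in> edges K" using f(1) im by simp
        then have "\<phi> ` e \<inter> \<phi> ` f \<noteq> {}"
          using meets[rule_format] image_mono[OF f(2)] unfolding e(2) by meson
        then show ?thesis using disj e(1) f(1) by simp
      qed
      moreover have "e \<subseteq> S" using e'(2) le[OF e(1) SV] unfolding e(2) by simp
      ultimately show ?thesis using e(1) by (intro bexI[of _ e]) simp_all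
    qed
  qed
qed

section \<open>Explicit edge sets and criticality\<close>

lemma edges_complete_4: "edges (complete_graph 4) = {{0,1}, {0,2}, {0,3}, {1,2}, {1,3}, {2,3}}"
proof -
  have "e \<in> edges (complete_graph 4) \<longleftrightarrow> e \<in> {{0,1}, {0,2}, {0,3}, {1,2}, {1,3}, {2,3}}" for e
  proof
    assume "e \<in> edges (complete_graph 4)"
    then obtain i j where e: "e = {i, j}" "i \<noteq> j" "i < 4" "j < 4"
      by (auto simp: complete_graph_def card_2_iff)
    define k l where "k = min i j" and "l = max i j"
    have "e = {k, l}" "k < l" "l < 4"
      using e by (auto simp: k_def l_def min_def max_def insert_commute)
    moreover from this have "k = 0 \<or> k = 1 \<or> k = 2" "l = 1 \<or> l = 2 \<or> l = 3" by linarith+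
    ultimately show "e \<in> {{0,1}, {0,2}, {0,3}, {1,2}, {1,3}, {2,3}}"
      by (elim disjE) simp_all
  qed (auto simp: complete_graph_def)
  then show ?thesis by (rule set_eqI)
qed

lemma edges_cycle_4: "edges (cycle_graph 4) = {{0,1}, {1,2}, {2,3}, {3,0}}"
proof -
  have "edges (cycle_graph 4) = (\<lambda>i. {i, (i + 1) mod 4}) ` {..<4}"
    by (auto simp: cycle_graph_def)
  also have "{..<4} = {0, 1, 2, 3::nat}" by auto
  moreover have "(0 + 1) mod 4 = (1 :: nat)" "(1 + 1) mod 4 = (2 :: nat)" "(2 + 1) mod 4 = (3 :: nat)" "(3 + 1) mod 4 = (0 :: nat)"
    by simp_all
  ultimately show ?thesis by (simp only: image_insert image_empty)
qed

lemma edges_cycle_5: "edges (cycle_graph 5) = {{0,1}, {1,2}, {2,3}, {3,4}, {4,0}}"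
proof -
  have "edges (cycle_graph 5) = (\<lambda>i. {i, (i + 1) mod 5}) ` {..<5}"
    by (auto simp: cycle_graph_def)
  also have "{..<5} = {0, 1, 2, 3, 4::nat}" by auto
  moreover have "(0 + 1) mod 5 = (1 :: nat)" "(1 + 1) mod 5 = (2 :: nat)" "(2 + 1) mod 5 = (3 :: nat)" "(3 + 1) mod 5 = (4 :: nat)" "(4 + 1) mod 5 = (0 :: nat)"
    by simp_all
  ultimately show ?thesis by (simp only: image_insert image_empty)
qed

text \<open>A form for explicit lists of edges: all quantifiers but the one over \<open>S\<close>
  are bounded, so the transversal condition becomes propositional in the memberships of vertices in
  \<open>S\<close>. A missing vertex replaces proper inclusion.\<close>

lemma critical_graphI:
  fixes E :: "nat set set"
  assumes "finite (\<Union>E)" "E \<noteq> {}" "\<forall>e\<in>E. card e = 2"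
    and "\<forall>e\<in>E. \<exists>f\<in>E. e \<inter> f = {}"
    and "\<And>S. \<exists>v\<in>\<Union>E. v \<notin> S \<Longrightarrow> \<exists>e\<in>E. e \<subseteq> S \<Longrightarrow>
          \<exists>e\<in>E. e \<subseteq> S \<and> (\<forall>f\<in>E. f \<subseteq> S \<longrightarrow> e \<inter> f \<noteq> {})"
    and "\<forall>e\<in>E. \<forall>f\<in>E. e \<inter> f = {} \<longrightarrow> (\<exists>g\<in>E. g \<subseteq> e \<union> f \<and> e \<inter> g \<noteq> {} \<and> f \<inter> g \<noteq> {})"
  shows "critical_graph E"
proof unfold_locales
  have "{} \<notin> E" using assms(3) by fastforce
  then show "hypergraph E" using assms(1,2) by (simp add: hypergraph_def)
  show "card e = 2" if "e \<in> E" for e using assms(3) that by simp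
  show "\<exists>f\<in>E. e \<inter> f = {}" if "e \<in> E" for e using assms(4) that by simp
  show "\<exists>e\<in>E. e \<subseteq> S \<and> (\<forall>f\<in>E. f \<subseteq> S \<longrightarrow> e \<inter> f \<noteq> {})"
    if "S \<subset> \<Union>E" "\<exists>e\<in>E. e \<subseteq> S" for S
    using assms(5)[of S] that by blast
  show "\<exists>g\<in>E. g \<subseteq> e \<union> f \<and> e \<inter> g \<noteq> {} \<and> f \<inter> g \<noteq> {}"
    if "e \<in> E" "f \<in> E" "e \<inter> f = {}" for e f
    using assms(6) that by simp
qed

lemma critical_complete_4: "critical_graph (edges (complete_graph 4))"
  unfolding edges_complete_4 by (rule critical_graphI) (simp_all, argo?)

lemma critical_cycle_4: "critical_graph (edges (cycle_graph 4))"
  unfolding edges_cycle_4 by (rule critical_graphI) (simp_all, argo?)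

lemma critical_cycle_5: "critical_graph (edges (cycle_graph 5))"
  unfolding edges_cycle_5 by (rule critical_graphI) (simp_all, argo?)

lemma critical_fan5: "critical_graph (edges fan5)"
  unfolding fan5_def snd_conv by (rule critical_graphI) (simp_all, argo?)

lemma critical_pendant_diamond: "critical_graph (edges pendant_diamond)"
  unfolding pendant_diamond_def snd_conv by (rule critical_graphI) (simp_all, argo?)

lemma critical_net_graph: "critical_graph (edges net_graph)"
  unfolding net_graph_def snd_conv by (rule critical_graphI) (simp_all, argo?)

lemma card_verts_edges:
  "card (verts (complete_graph 4)) = 4" "card (edges (complete_graph 4)) = 6"
  "card (verts (cycle_graph 4)) = 4" "card (edges (cycle_graph 4)) = 4"
  "card (verts (cycle_graph 5)) = 5" "card (edges (cycle_graph 5)) = 5"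
  "card (verts fan5) = 5" "card (edges fan5) = 7"
  "card (verts pendant_diamond) = 5" "card (edges pendant_diamond) = 6"
  "card (verts net_graph) = 6" "card (edges net_graph) = 6"
  unfolding edges_complete_4 edges_cycle_4 edges_cycle_5
  by (simp_all add: complete_graph_def cycle_graph_def fan5_def pendant_diamond_def net_graph_def
      doubleton_eq_iff)

section \<open>Classification\<close>

context critical_graph
begin

definition adj :: "'a \<Rightarrow> 'a \<Rightarrow> bool" where
  "adj u v \<longleftrightarrow> {u, v} \<in> E"

lemma adj_sym: "adj u v \<longleftrightarrow> adj v u"
  by (simp add: adj_def insert_commute)

lemma adj_irrefl [simp]: "\<not> adj u u"
  using card_edge[of "{u, u}"] by (auto simp: adj_def)

lemma adj_in_V: "adj u v \<Longrightarrow> u \<in> V" "adj u v \<Longrightarrow> v \<in> V"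
  by (auto simp: adj_def)

lemma adj_disjoint:
  assumes "adj u v"
  obtains p q where "adj p q" "{p, q} \<inter> {u, v} = {}"
proof -
  obtain f where f: "f \<in> E" "{u, v} \<inter> f = {}" using disjoint_edge assms unfolding adj_def by blast
  obtain p q where "f = {p, q}" using card_edge[OF f(1)] by (auto simp: card_2_iff)
  then show thesis using that[of p q] f by (auto simp: adj_def)
qed

lemma adj_link:
  assumes "adj a b" "adj c d" "{a, b} \<inter> {c, d} = {}"
  shows "adj a c \<or> adj a d \<or> adj b c \<or> adj b d"
proof -
  obtain g where g: "g \<in> E" "g \<subseteq> {a, b} \<union> {c, d}" "{a, b} \<inter> g \<noteq> {}" "{c, d} \<inter> g \<noteq> {}"
    using linking_edge[of "{a, b}" "{c, d}"] assms unfolding adj_def by blast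
  obtain u v where uv: "u \<in> {a, b}" "u \<in> g" "v \<in> {c, d}" "v \<in> g" using g(3,4) by blast
  then have "u \<noteq> v" using assms(3) by blast
  then have "card {u, v} = card g" using card_edge[OF g(1)] by simp
  moreover have "finite g" using card_edge[OF g(1)] by (metis card.infinite zero_neq_numeral)
  ultimately have "{u, v} = g" using uv by (intro card_subset_eq) auto
  then show ?thesis using g(1) uv by (auto simp: adj_def)
qed

text \<open>A copy that misses a vertex would, by \<open>transversal_edge\<close>, contain an edge
  meeting all its edges, whereas every edge of \<open>K\<close> has a disjoint one. So the copy
  covers all of \<open>V\<close>.\<close>

lemma induced_copy_imp_iso:
  fixes K :: "nat graph"
  assumes K: "simple_graph K" "critical_graph (edges K)"
    and inj: "inj_on \<phi> (verts K)" and im: "\<phi> ` verts K \<subseteq> V"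
    and edge: "\<And>i j. i \<in> verts K \<Longrightarrow> j \<in> verts K \<Longrightarrow> {i, j} \<in> edges K \<longleftrightarrow> adj (\<phi> i) (\<phi> j)"
  shows "graph_iso (V, E) K"
proof -
  interpret K: critical_graph "edges K" by (fact K(2))
  have sub: "e \<subseteq> verts K" if "e \<in> edges K" for e using K(1) that by (simp add: simple_graph_def)
  let ?S = "\<phi> ` verts K"
  have into: "\<phi> ` e \<in> E" if "e \<in> edges K" for e
  proof -
    obtain i j where "e = {i, j}" using K.card_edge[OF \<open>e \<in> edges K\<close>] by (auto simp: card_2_iff)
    then show ?thesis using edge[of i j] sub[OF that] that by (simp add: adj_def)
  qed
  have onto: "\<exists>e\<in>edges K. f = \<phi> ` e" if f: "f \<in> E" "f \<subseteq> ?S" for f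
  proof -
    obtain u v where uv: "f = {u, v}" using card_edge[OF f(1)] by (auto simp: card_2_iff)
    then obtain i j where ij: "i \<in> verts K" "j \<in> verts K" "u = \<phi> i" "v = \<phi> j" using f(2) by auto
    then show ?thesis using edge[of i j] uv f(1) by (intro bexI[of _ "{i, j}"]) (simp_all add: adj_def)
  qed
  have "\<not> ?S \<subset> V"
  proof
    assume psub: "?S \<subset> V"
    obtain e0 where "e0 \<in> edges K" using K.hyp by (auto simp: hypergraph_def)
    then have "\<exists>e\<in>E. e \<subseteq> ?S" using into sub by (intro bexI[of _ "\<phi> ` e0"] image_mono)
    from transversal_edge[OF psub this] obtain e where e: "e \<in> E" "e \<subseteq> ?S"
      and meets: "\<forall>f\<in>E. f \<subseteq> ?S \<longrightarrow> e \<inter> f \<noteq> {}"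
      by (elim bexE conjE)
    obtain e' where e': "e' \<in> edges K" "e = \<phi> ` e'" using onto[OF e] by blast
    obtain f' where f': "f' \<in> edges K" "e' \<inter> f' = {}" using K.disjoint_edge[OF e'(1)] by blast
    have "e \<inter> \<phi> ` f' = {}"
      using inj_on_image_Int[OF inj sub[OF e'(1)] sub[OF f'(1)]] f'(2) e'(2) by simp
    moreover have "\<phi> ` f' \<subseteq> ?S" using sub[OF f'(1)] by (rule image_mono)
    ultimately show False using meets into[OF f'(1)] by simp
  qed
  then have V: "?S = V" using im by blast
  have "(\<lambda>e. \<phi> ` e) ` edges K = E"
  proof
    show "(\<lambda>e. \<phi> ` e) ` edges K \<subseteq> E" using into by blast
    show "E \<subseteq> (\<lambda>e. \<phi> ` e) ` edges K"
    proof
      fix f assume "f \<in> E"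
      then show "f \<in> (\<lambda>e. \<phi> ` e) ` edges K" using onto[of f] V by blast
    qed
  qed
  then have "graph_iso K (V, E)"
    unfolding graph_iso_def using inj V by (intro exI[of _ \<phi>]) (simp add: bij_betw_def)
  then show ?thesis using graph_iso_sym sub by blast
qed

text \<open>List form for small graphs: vertex \<open>i\<close> goes to entry \<open>i\<close>, and
  by symmetry only the pairs \<open>j < i\<close> have to be checked.\<close>

lemma induced_list_imp_iso:
  fixes K :: "nat graph"
  assumes K: "simple_graph K" "critical_graph (edges K)" "verts K = {..<length xs}"
    and xs: "distinct xs" "set xs \<subseteq> V"
    and edge: "\<forall>i<length xs. \<forall>j<i. {i, j} \<in> edges K \<longleftrightarrow> adj (xs ! i) (xs ! j)"
  shows "graph_iso (V, E) K"
proof (rule induced_copy_imp_iso[OF K(1,2), of "(!) xs"])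
  show "inj_on ((!) xs) (verts K)" using xs(1) K(3) by (simp add: inj_on_nth)
  show "(!) xs ` verts K \<subseteq> V" 
  proof
    fix v assume "v \<in> (!) xs ` verts K"
    then obtain i where "i < length xs" "v = xs ! i" using K(3) by auto
    then have "v \<in> set xs" by simp
    then show "v \<in> V" using xs(2) by (rule subsetD[rotated])
  qed
  fix i j assume ij: "i \<in> verts K" "j \<in> verts K"
  consider "j < i" | "i < j" | "i = j" by linarith
  then show "{i, j} \<in> edges K \<longleftrightarrow> adj (xs ! i) (xs ! j)"
  proof cases
    case 1
    then show ?thesis using ij edge K(3) by simp
  next
    case 2
    then have "{j, i} \<in> edges K \<longleftrightarrow> adj (xs ! j) (xs ! i)" using ij edge K(3) by simp
    then show ?thesis unfolding adj_sym[of "xs ! i" "xs ! j"] insert_commute[of i j "{}"] .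
  next
    case 3
    have "{i} \<notin> edges K" using K(1) by (auto simp: simple_graph_def)
    then show ?thesis using 3 by simp
  qed
qed

end

lemma lessThan_4: "{..<4} = {0, 1, 2, 3 :: nat}"
  by auto

lemma lessThan_5: "{..<5} = {0, 1, 2, 3, 4 :: nat}"
  by auto

lemma lessThan_6: "{..<6} = {0, 1, 2, 3, 4, 5 :: nat}"
  by auto

lemma simple_six: "K \<in> six_graphs \<Longrightarrow> simple_graph K \<and> no_isolated_vertices K"
proof -
  have 1: "simple_graph (complete_graph 4) \<and> no_isolated_vertices (complete_graph 4)"
    unfolding simple_graph_def no_isolated_vertices_def edges_complete_4
    by (simp add: complete_graph_def lessThan_4 lessThan_5 lessThan_6)
  have 2: "simple_graph (cycle_graph 4) \<and> no_isolated_vertices (cycle_graph 4)"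
    unfolding simple_graph_def no_isolated_vertices_def edges_cycle_4
    by (simp add: cycle_graph_def lessThan_4 lessThan_5 lessThan_6)
  have 3: "simple_graph (cycle_graph 5) \<and> no_isolated_vertices (cycle_graph 5)"
    unfolding simple_graph_def no_isolated_vertices_def edges_cycle_5
    by (simp add: cycle_graph_def lessThan_4 lessThan_5 lessThan_6)
  have 4: "simple_graph fan5 \<and> no_isolated_vertices fan5"
    unfolding simple_graph_def no_isolated_vertices_def fan5_def
    by (simp add: lessThan_4 lessThan_5 lessThan_6)
  have 5: "simple_graph pendant_diamond \<and> no_isolated_vertices pendant_diamond"
    unfolding simple_graph_def no_isolated_vertices_def pendant_diamond_def
    by (simp add: lessThan_4 lessThan_5 lessThan_6)
  have 6: "simple_graph net_graph \<and> no_isolated_vertices net_graph"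
    unfolding simple_graph_def no_isolated_vertices_def net_graph_def
    by (simp add: lessThan_4 lessThan_5 lessThan_6)
  assume "K \<in> six_graphs"
  then show ?thesis unfolding six_graphs_def using 1 2 3 4 5 6 by (elim insertE emptyE) simp_all
qed

context critical_graph
begin

section \<open>Induced copies of the six graphs\<close>

lemma K4_iso:
  assumes "adj a b" "adj a c" "adj a d" "adj b c" "adj b d" "adj c d"
  shows "graph_iso (V, E) (complete_graph 4)"
proof (rule induced_list_imp_iso[where xs = "[a, b, c, d]"])
  show "simple_graph (complete_graph 4)" using simple_six by (simp add: six_graphs_def)
  show "critical_graph (edges (complete_graph 4))" by (rule critical_complete_4)
  show "verts (complete_graph 4) = {..<length [a, b, c, d]}" by (simp add: complete_graph_def)
  show "\<forall>i<length [a, b, c, d]. \<forall>j<i.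
      {i, j} \<in> edges (complete_graph 4) \<longleftrightarrow> adj ([a, b, c, d] ! i) ([a, b, c, d] ! j)"
    using assms unfolding edges_complete_4
    by (simp add: numeral_eq_Suc All_less_Suc doubleton_eq_iff adj_sym)
  show "set [a, b, c, d] \<subseteq> V" using assms by (auto dest: adj_in_V)
  show "distinct [a, b, c, d]" using assms by (auto simp: adj_sym)
qed

text \<open>Opposite vertices of a 4-cycle have the same neighbours, so their distinctness has to be
  assumed. In the other five graphs the adjacencies already keep the vertices apart.\<close>

lemma C4_iso:
  assumes "adj a b" "adj b c" "adj c d" "adj d a"
    and "\<not> adj a c" "\<not> adj b d"
    and "a \<noteq> c" "b \<noteq> d"
  shows "graph_iso (V, E) (cycle_graph 4)"
proof (rule induced_list_imp_iso[where xs = "[a, b, c, d]"])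
  show "simple_graph (cycle_graph 4)" using simple_six by (simp add: six_graphs_def)
  show "critical_graph (edges (cycle_graph 4))" by (rule critical_cycle_4)
  show "verts (cycle_graph 4) = {..<length [a, b, c, d]}" by (simp add: cycle_graph_def)
  show "\<forall>i<length [a, b, c, d]. \<forall>j<i.
      {i, j} \<in> edges (cycle_graph 4) \<longleftrightarrow> adj ([a, b, c, d] ! i) ([a, b, c, d] ! j)"
    using assms unfolding edges_cycle_4
    by (simp add: numeral_eq_Suc All_less_Suc doubleton_eq_iff adj_sym)
  show "set [a, b, c, d] \<subseteq> V" using assms by (auto dest: adj_in_V)
  show "distinct [a, b, c, d]" using assms by (auto simp: adj_sym)
qed

lemma C5_iso:
  assumes "adj a b" "adj b c" "adj c d" "adj d e" "adj e a"
    and "\<not> adj a c" "\<not> adj a d" "\<not> adj b d" "\<not> adj b e" "\<not> adj c e"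
  shows "graph_iso (V, E) (cycle_graph 5)"
proof (rule induced_list_imp_iso[where xs = "[a, b, c, d, e]"])
  show "simple_graph (cycle_graph 5)" using simple_six by (simp add: six_graphs_def)
  show "critical_graph (edges (cycle_graph 5))" by (rule critical_cycle_5)
  show "verts (cycle_graph 5) = {..<length [a, b, c, d, e]}" by (simp add: cycle_graph_def)
  show "\<forall>i<length [a, b, c, d, e]. \<forall>j<i.
      {i, j} \<in> edges (cycle_graph 5) \<longleftrightarrow> adj ([a, b, c, d, e] ! i) ([a, b, c, d, e] ! j)"
    using assms unfolding edges_cycle_5
    by (simp add: numeral_eq_Suc All_less_Suc doubleton_eq_iff adj_sym)
  show "set [a, b, c, d, e] \<subseteq> V" using assms by (auto dest: adj_in_V)
  show "distinct [a, b, c, d, e]" using assms by (auto simp: adj_sym)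
qed

lemma fan5_iso:
  assumes "adj a b" "adj b c" "adj c d" "adj e a" "adj e b" "adj e c" "adj e d"
    and "\<not> adj a c" "\<not> adj a d" "\<not> adj b d"
  shows "graph_iso (V, E) fan5"
proof (rule induced_list_imp_iso[where xs = "[a, b, c, d, e]"])
  show "simple_graph fan5" using simple_six by (simp add: six_graphs_def)
  show "critical_graph (edges fan5)" by (rule critical_fan5)
  show "verts fan5 = {..<length [a, b, c, d, e]}" by (simp add: fan5_def)
  show "\<forall>i<length [a, b, c, d, e]. \<forall>j<i.
      {i, j} \<in> edges fan5 \<longleftrightarrow> adj ([a, b, c, d, e] ! i) ([a, b, c, d, e] ! j)"
    using assms unfolding fan5_def snd_conv
    by (simp add: numeral_eq_Suc All_less_Suc doubleton_eq_iff adj_sym)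
  show "set [a, b, c, d, e] \<subseteq> V" using assms by (auto dest: adj_in_V)
  show "distinct [a, b, c, d, e]" using assms by (auto simp: adj_sym)
qed

lemma pendant_diamond_iso:
  assumes "adj a b" "adj b c" "adj a c" "adj c d" "adj d a" "adj d e"
    and "\<not> adj a e" "\<not> adj b d" "\<not> adj b e" "\<not> adj c e"
  shows "graph_iso (V, E) pendant_diamond"
proof (rule induced_list_imp_iso[where xs = "[a, b, c, d, e]"])
  show "simple_graph pendant_diamond" using simple_six by (simp add: six_graphs_def)
  show "critical_graph (edges pendant_diamond)" by (rule critical_pendant_diamond)
  show "verts pendant_diamond = {..<length [a, b, c, d, e]}" by (simp add: pendant_diamond_def)
  show "\<forall>i<length [a, b, c, d, e]. \<forall>j<i.
      {i, j} \<in> edges pendant_diamond \<longleftrightarrow> adj ([a, b, c, d, e] ! i) ([a, b, c, d, e] ! j)"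
    using assms unfolding pendant_diamond_def snd_conv
    by (simp add: numeral_eq_Suc All_less_Suc doubleton_eq_iff adj_sym)
  show "set [a, b, c, d, e] \<subseteq> V" using assms by (auto dest: adj_in_V)
  show "distinct [a, b, c, d, e]" using assms by (auto simp: adj_sym)
qed

lemma net_iso:
  assumes "adj a b" "adj b c" "adj c a" "adj a a'" "adj b b'" "adj c c'"
    and "\<not> adj a b'" "\<not> adj a c'" "\<not> adj b a'" "\<not> adj b c'" "\<not> adj c a'" "\<not> adj c b'" "\<not> adj a' b'" "\<not> adj a' c'" "\<not> adj b' c'"
  shows "graph_iso (V, E) net_graph"
proof (rule induced_list_imp_iso[where xs = "[a, b, c, a', b', c']"])
  show "simple_graph net_graph" using simple_six by (simp add: six_graphs_def)
  show "critical_graph (edges net_graph)" by (rule critical_net_graph)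
  show "verts net_graph = {..<length [a, b, c, a', b', c']}" by (simp add: net_graph_def)
  show "\<forall>i<length [a, b, c, a', b', c']. \<forall>j<i.
      {i, j} \<in> edges net_graph \<longleftrightarrow> adj ([a, b, c, a', b', c'] ! i) ([a, b, c, a', b', c'] ! j)"
    using assms unfolding net_graph_def snd_conv
    by (simp add: numeral_eq_Suc All_less_Suc doubleton_eq_iff adj_sym)
  show "set [a, b, c, a', b', c'] \<subseteq> V" using assms by (auto dest: adj_in_V)
  show "distinct [a, b, c, a', b', c']" using assms by (auto simp: adj_sym)
qed

end

section \<open>Every critical graph is one of the six\<close>

lemma finite_maximizer:
  fixes F :: "'b \<Rightarrow> nat"
  assumes "finite S" "S \<noteq> {}"
  obtains t where "t \<in> S" "\<And>s. s \<in> S \<Longrightarrow> F s \<le> F t"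
proof -
  have "Max (F ` S) \<in> F ` S" using assms by (intro Max_in) auto
  then obtain t where t: "t \<in> S" "F t = Max (F ` S)" by auto
  show thesis
  proof (rule that[OF t(1)])
    show "F s \<le> F t" if "s \<in> S" for s
      unfolding t(2) using assms(1) that by (intro Max_ge) auto
  qed
qed

context critical_graph
begin

definition degree :: "'a \<Rightarrow> nat" where
  "degree v = card {w. adj v w}"

text \<open>Otherwise the neighbours of \<open>c\<close> would form a proper subset of those of
  \<open>v\<close>, against the degrees.\<close>

lemma degree_exchange:
  assumes "degree v \<le> degree c" "adj v u" "\<not> adj c u"
  obtains w where "adj c w" "\<not> adj v w"
proof -
  have fin: "finite {w. adj v w}"
    by (rule finite_subset[OF _ finite_V]) (use adj_in_V(2) in blast)
  have "\<not> {w. adj c w} \<subset> {w. adj v w}"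
    using psubset_card_mono[OF fin, of "{w. adj c w}"] assms(1) by (auto simp: degree_def)
  then have "\<not> {w. adj c w} \<subseteq> {w. adj v w}" using assms(2,3) by blast
  then show thesis using that by blast
qed

text \<open>A triangle of maximal degree sum, or an edge if there is no triangle, serves as the
  clique. When an outside vertex could replace one of its vertices, maximality compares their
  degrees, \<open>degree_exchange\<close> supplies a further vertex, and a forbidden induced copy
  appears.\<close>

lemma isomorphic_six_graphs: "\<exists>K\<in>six_graphs. graph_iso (V, E) K"
proof (rule ccontr)
  assume no: "\<not> ?thesis"
  have K4: False if "adj a b" "adj a c" "adj a d" "adj b c" "adj b d" "adj c d" for a b c d
    using no K4_iso[OF that] by (simp add: six_graphs_def)
  have C4: "adj a c \<or> adj b d" if "adj a b" "adj b c" "adj c d" "adj d a" "a \<noteq> c" "b \<noteq> d" for a b c d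
    using no C4_iso[of a b c d] that by (auto simp: six_graphs_def)
  have C5: "adj a c \<or> adj a d \<or> adj b d \<or> adj b e \<or> adj c e"
    if "adj a b" "adj b c" "adj c d" "adj d e" "adj e a" for a b c d e
    using no C5_iso[of a b c d e] that by (auto simp: six_graphs_def)
  show False
  proof (cases "\<exists>a b c. adj a b \<and> adj a c \<and> adj b c")
    case False
    then have tri: False if "adj x y" "adj x z" "adj y z" for x y z using that by blast
    obtain e where "e \<in> E" using hyp by (auto simp: hypergraph_def)
    then obtain a0 b0 where "adj a0 b0" using edge_endpoints[of e] unfolding adj_def by metis
    have fin: "finite {(x, y). adj x y}"
      by (rule finite_subset[OF _ finite_cartesian_product[OF finite_V finite_V]])
        (use adj_in_V in blast)
    have ne: "{(x, y). adj x y} \<noteq> {}" using \<open>adj a0 b0\<close> by blast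
    obtain a b where ab: "adj a b"
      and max: "\<And>x y. adj x y \<Longrightarrow> degree x + degree y \<le> degree a + degree b"
    proof (rule finite_maximizer[OF fin ne, of "\<lambda>(x, y). degree x + degree y"])
      fix t assume t: "t \<in> {(x, y). adj x y}"
        "\<And>s. s \<in> {(x, y). adj x y} \<Longrightarrow>
          (case s of (x, y) \<Rightarrow> degree x + degree y) \<le> (case t of (x, y) \<Rightarrow> degree x + degree y)"
      show thesis
      proof (rule that[of "fst t" "snd t"])
        show "degree x + degree y \<le> degree (fst t) + degree (snd t)" if "adj x y" for x y
          using t(2)[of "(x, y)"] that by (simp add: case_prod_beta)
      qed (use t(1) in auto)
    qed
    \<comment> \<open>The path \<open>a\<close>, \<open>b\<close>, \<open>u\<close>,
      \<open>v\<close> is induced. Since \<open>u\<close> could replace \<open>a\<close> in the edge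
      at \<open>b\<close>, its degree is at most that of \<open>a\<close>, so some neighbour
      \<open>w\<close> of \<open>a\<close> misses \<open>u\<close>. The link between the edges
      \<open>{a, w}\<close> and \<open>{u, v}\<close> closes an induced 5-cycle.\<close>
    have core: False
      if e: "adj a b" "adj u v" "adj b u" and dist: "u \<noteq> a" "v \<noteq> a" "v \<noteq> b"
        and max: "\<And>x y. adj x y \<Longrightarrow> degree x + degree y \<le> degree a + degree b" for a b u v
    proof -
      have bu: "adj u b" "adj b a" "adj v u" using e(1-3) by (simp_all add: adj_sym)
      have n: "\<not> adj a u" "\<not> adj b v" using tri e(1-3) bu by blast+
      have av: "\<not> adj a v" using C4[of a b u v] n e(1-3) dist adj_sym[of v a] by blast
      have "degree u \<le> degree a" using max[OF bu(1)] by simp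
      then obtain w where w: "adj a w" "\<not> adj u w" using degree_exchange e(2) av by blast
      then have "w \<noteq> b" "w \<noteq> u" "w \<noteq> v" using bu n av by auto
      then have "adj w v" using adj_link[of a w u v] w n av e(2) dist adj_sym[of w u] by auto
      moreover have "\<not> adj b w" using tri[of a b w] e(1) w(1) by blast
      ultimately show False
        using C5[of a b u v w] e(1-3) n av w adj_sym[of w v] adj_sym[of w a] by blast
    qed
    obtain p q where pq: "adj p q" "{p, q} \<inter> {a, b} = {}" using adj_disjoint[OF ab] .
    have ba: "adj b a" and qp: "adj q p" using ab pq by (simp_all add: adj_sym)
    have max': "\<And>x y. adj x y \<Longrightarrow> degree x + degree y \<le> degree b + degree a"
      using max by (simp add: add.commute)
    have "adj a p \<or> adj a q \<or> adj b p \<or> adj b q" using adj_link[OF ab pq(1)] pq(2) by blast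
    then show False
      using core[OF ba pq(1) _ _ _ _ max'] core[OF ba qp _ _ _ _ max']
        core[OF ab pq(1) _ _ _ _ max] core[OF ab qp _ _ _ _ max] pq(2) by blast
  next
    case True
    then obtain a0 b0 c0 where "adj a0 b0" "adj a0 c0" "adj b0 c0" by blast
    let ?T = "{(x, y, z). adj x y \<and> adj x z \<and> adj y z}"
    have fin: "finite ?T"
      by (rule finite_subset[OF _ finite_cartesian_product[OF finite_V
              finite_cartesian_product[OF finite_V finite_V]]])
        (use adj_in_V in blast)
    have ne: "?T \<noteq> {}" using \<open>adj a0 b0\<close> \<open>adj a0 c0\<close> \<open>adj b0 c0\<close> by blast
    obtain a b c where abc: "adj a b" "adj a c" "adj b c"
      and max: "\<And>x y z. adj x y \<Longrightarrow> adj x z \<Longrightarrow> adj y z \<Longrightarrow>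
          degree x + degree y + degree z \<le> degree a + degree b + degree c"
    proof (rule finite_maximizer[OF fin ne, of "\<lambda>(x, y, z). degree x + degree y + degree z"])
      fix t assume t: "t \<in> ?T"
        "\<And>s. s \<in> ?T \<Longrightarrow> (case s of (x, y, z) \<Rightarrow> degree x + degree y + degree z)
          \<le> (case t of (x, y, z) \<Rightarrow> degree x + degree y + degree z)"
      show thesis
      proof (rule that[of "fst t" "fst (snd t)" "snd (snd t)"])
        show "degree x + degree y + degree z
            \<le> degree (fst t) + degree (fst (snd t)) + degree (snd (snd t))"
          if "adj x y" "adj x z" "adj y z" for x y z
          using t(2)[of "(x, y, z)"] that by (simp add: case_prod_beta)
      qed (use t(1) in auto)
    qed
    have sym: "adj b a" "adj c a" "adj c b" using abc by (simp_all add: adj_sym)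
    \<comment> \<open>A neighbour \<open>w\<close> of \<open>c\<close> that misses \<open>v\<close>
      must be adjacent to \<open>u\<close>. Both \<open>a\<close> and \<open>b\<close> are common
      neighbours of \<open>v\<close> and \<open>c\<close>; each has to be adjacent to
      \<open>u\<close>, as otherwise it lies on an induced 4-cycle or 5-cycle with \<open>v\<close>,
      \<open>u\<close>, \<open>w\<close>. Then \<open>a\<close>, \<open>b\<close>, \<open>u\<close>,
      \<open>v\<close> form a complete graph.\<close>
    have core: False
      if t: "adj a b" "adj a c" "adj b c" and uv: "adj u v" "adj a v" "adj b v"
        and n: "\<not> adj c v" "\<not> adj c u"
        and d: "degree v \<le> degree c" for a b c u v
    proof -
      have "adj v u" using uv(1) by (simp add: adj_sym)
      then obtain w where w: "adj c w" "\<not> adj v w" using degree_exchange[OF d _ n(2)] by blast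
      have s: "adj v a" "adj v b" "adj c a" "adj c b" using uv t by (simp_all add: adj_sym)
      have neq: "w \<noteq> a" "w \<noteq> b" "w \<noteq> u" "w \<noteq> v" "u \<noteq> c" "v \<noteq> c"
        using w s n \<open>adj v u\<close> t adj_sym[of v c] adj_sym[of u v] by auto
      have wu: "adj u w"
        using adj_link[of c w u v] w n neq uv(1) adj_sym[of w u] adj_sym[of w v] by auto
      have "adj x u" if x: "adj x v" "adj x c" "x \<noteq> u" "x \<noteq> w" for x
      proof (rule ccontr)
        assume xu: "\<not> adj x u"
        show False
        proof (cases "adj x w")
          case True
          then show False
            using C4[of x v u w] x xu w(2) wu \<open>adj v u\<close> neq adj_sym[of w x] by blast
        next
          case False
          then show False
            using C5[of x v u w c] x xu w n wu \<open>adj v u\<close>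
              adj_sym[of w c] adj_sym[of c x] adj_sym[of c u] adj_sym[of c v] by blast
        qed
      qed
      moreover have "a \<noteq> u" "b \<noteq> u" using n(2) s by auto
      ultimately have "adj a u" "adj b u" using uv t neq by blast+
      then show False using K4[of a b u v] t uv by blast
    qed
    \<comment> \<open>The degree condition of \<open>core\<close> comes from maximality, applied to
      the triangle in which \<open>v\<close> replaces \<open>z\<close>.\<close>
    have core': False
      if "{x, y, z} = {a, b, c}" "adj x y" "adj x z" "adj y z"
        and "degree x + degree y + degree z = degree a + degree b + degree c"
        and "adj u v" "adj x v" "adj y v" "\<not> adj z v" "\<not> adj z u" for x y z u v
      using core[of x y z u v] max[of x y v] that by simp
    \<comment> \<open>Suppose \<open>{p, q}\<close> avoids the triangle. As there is no induced
      4-cycle, the neighbourhoods of \<open>p\<close> and \<open>q\<close> in the triangle are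
      nested. By the linking edges and the absence of a complete graph on 4 vertices, the larger one
      has exactly two elements, which \<open>core'\<close> excludes.\<close>
    have touch: "p \<in> {a, b, c} \<or> q \<in> {a, b, c}" if pq: "adj p q" for p q
    proof (rule ccontr)
      assume "\<not> ?thesis"
      then have out: "p \<noteq> a" "p \<noteq> b" "p \<noteq> c" "q \<noteq> a" "q \<noteq> b" "q \<noteq> c" by auto
      have qp: "adj q p" using pq by (simp add: adj_sym)
      have link: "adj x p \<or> adj x q \<or> adj y p \<or> adj y q"
        if "adj x y" "x \<in> {a, b, c}" "y \<in> {a, b, c}" for x y
        using adj_link[OF that(1) pq] that(2,3) out by auto
      have square: "adj x q \<or> adj y p"
        if "adj x y" "x \<in> {a, b, c}" "y \<in> {a, b, c}" "adj x p" "adj y q" for x y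
        using C4[of x p q y] that pq out adj_sym[of q y] adj_sym[of y x] adj_sym[of p y] by auto
      have "\<not> (adj a p \<and> adj b p \<and> adj c p)" "\<not> (adj a q \<and> adj b q \<and> adj c q)"
        using K4[of a b c] abc by blast+
      moreover note link[OF abc(1)] link[OF abc(2)] link[OF abc(3)]
      moreover note square[OF abc(1)] square[OF abc(2)] square[OF abc(3)]
        square[OF sym(1)] square[OF sym(2)] square[OF sym(3)]
      moreover note core'[of a b c p q] core'[of a b c q p]
      moreover note core'[of a c b p q] core'[of a c b q p]
      moreover note core'[of b c a p q] core'[of b c a q p]
      ultimately show False using abc sym pq qp
        by (simp add: insert_commute) argo
    qed
    \<comment> \<open>An edge disjoint from \<open>{y, w}\<close> still touches the triangle, hence
      contains \<open>x\<close>.\<close>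
    have pend: "\<exists>z. adj x z \<and> z \<notin> {x, y, w}" if yw: "adj y w" "{x, y, w} = {a, b, c}" for x y w
    proof -
      obtain r s where rs: "adj r s" "{r, s} \<inter> {y, w} = {}" using adj_disjoint[OF yw(1)] .
      then have "r = x \<or> s = x" using touch[OF rs(1)] unfolding yw(2)[symmetric] by blast
      then show ?thesis
      proof
        assume "r = x"
        then show ?thesis using rs by (intro exI[of _ s]) auto
      next
        assume "s = x"
        then show ?thesis using rs adj_sym[of r s] by (intro exI[of _ r]) auto
      qed
    qed
    \<comment> \<open>By \<open>touch\<close>, \<open>x'\<close> and \<open>p\<close> are not
      adjacent. If \<open>x'\<close> is adjacent to neither, one or both of \<open>y\<close> and
      \<open>z\<close>, the result is a diamond with a pendant edge, a fan or a complete graph on 4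
      vertices, respectively.\<close>
    have core2: False
      if t: "adj x y" "adj x z" "adj y z" "{x, y, z} = {a, b, c}" and p: "adj y p" "adj z p" "p \<notin> {x, y, z}"
        and x': "adj x x'" "x' \<notin> {x, y, z}" for x y z p x'
    proof -
      have n: "\<not> adj x p" "\<not> adj x' p"
        using K4[OF t(1,2) _ t(3) p(1,2)] touch[of x' p] p(3) x'(2) t(4) by auto
      have n': "\<not> (adj x' y \<and> adj x' z)"
        using K4[OF t(1,2) x'(1) t(3)] adj_sym[of x'] by blast
      have pd: False if "\<not> adj x' y" "\<not> adj x' z"
        using no pendant_diamond_iso[of y p z x x'] that n t p x'(1) by (simp add: six_graphs_def adj_sym)
      have f1: False if "adj x' y" "\<not> adj x' z"
        using no fan5_iso[of x' x z p y] that n t p x'(1) by (simp add: six_graphs_def adj_sym)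
      have f2: False if "adj x' z" "\<not> adj x' y"
        using no fan5_iso[of x' x y p z] that n t p x'(1) by (simp add: six_graphs_def adj_sym)
      show False using n' pd f1 f2 by blast
    qed
    have T: "{b, a, c} = {a, b, c}" "{c, a, b} = {a, b, c}" by blast+
    obtain a' where a': "adj a a'" "a' \<notin> {a, b, c}" using pend[OF abc(3)] by blast
    obtain b' where b': "adj b b'" "b' \<notin> {b, a, c}" using pend[OF abc(2) T(1)] by blast
    obtain c' where c': "adj c c'" "c' \<notin> {c, a, b}" using pend[OF abc(1) T(2)] by blast
    \<comment> \<open>An outside vertex adjacent to two vertices of the triangle contradicts
      \<open>core2\<close>, applied with the outside neighbour of the third. So the outside
      neighbours are private, and with \<open>touch\<close> they form a net.\<close>
    have "\<not> adj b a'" "\<not> adj a b'"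
      using core2[OF sym(2,3) abc(1) T(2) _ _ _ c'] a' b' by auto
    moreover have "\<not> adj c a'" "\<not> adj a c'"
      using core2[OF sym(1) abc(3,2) T(1) _ _ _ b'] a' c' by auto
    moreover have "\<not> adj c b'" "\<not> adj b c'"
      using core2[OF abc(1,2,3) refl _ _ _ a'] b' c' by auto
    moreover have "\<not> adj a' b'" "\<not> adj a' c'" "\<not> adj b' c'"
      using touch[of a' b'] touch[of a' c'] touch[of b' c'] a'(2) b'(2) c'(2) by blast+
    ultimately show False
      using no net_iso[of a b c a' b' c'] abc a'(1) b'(1) c'(1) by (simp add: six_graphs_def adj_sym)
  qed
qed

end

section \<open>The six graphs are pairwise nonisomorphic\<close>

lemma critical_six: "K \<in> six_graphs \<Longrightarrow> critical_graph (edges K)"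
  unfolding six_graphs_def
  using critical_complete_4 critical_cycle_4 critical_cycle_5 critical_fan5
    critical_pendant_diamond critical_net_graph
  by (elim insertE emptyE) simp_all

definition size_invariant :: "'b graph \<Rightarrow> nat \<times> nat" where
  "size_invariant K = (card (verts K), card (edges K))"

text \<open>The invariant takes six values on a set listed with six entries. This shows at once that
  the entries are distinct and that the invariant separates them.\<close>

lemma card_six_graphs: "card six_graphs = 6"
  and inj_on_size_invariant: "inj_on size_invariant six_graphs"
proof -
  have "size_invariant ` six_graphs = {(4, 6), (4, 4), (5, 5), (5, 7), (5, 6), (6, 6)}"
    by (simp add: six_graphs_def size_invariant_def card_verts_edges)
  then have im: "card (size_invariant ` six_graphs) = 6" by simp
  have fin: "finite six_graphs" by (simp add: six_graphs_def)
  have "card six_graphs \<le> 6"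
    using card_length[of "[complete_graph 4, cycle_graph 4, cycle_graph 5, fan5, pendant_diamond, net_graph]"]
    by (simp add: six_graphs_def)
  then show card: "card six_graphs = 6" using card_image_le[OF fin, of size_invariant] im by simp
  show "inj_on size_invariant six_graphs" using im card by (intro eq_card_imp_inj_on[OF fin]) simp
qed

lemma six_graphs_nonisomorphic: "pairwise (\<lambda>K K'. \<not> graph_iso K K') six_graphs"
proof (rule pairwiseI, rule notI)
  fix K K' assume K: "K \<in> six_graphs" "K' \<in> six_graphs" "K \<noteq> K'" and iso: "graph_iso K K'"
  have "\<forall>e\<in>edges K. e \<subseteq> verts K" using simple_six[OF K(1)] by (simp add: simple_graph_def)
  from graph_iso_cards[OF iso this] have "size_invariant K = size_invariant K'"
    by (simp add: size_invariant_def)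
  then show False using inj_on_size_invariant K by (auto dest: inj_onD)
qed

text \<open>The six graphs are shown to be JM also as graphs on natural numbers, since a type
  \<open>'a\<close> with few elements may contain no copies of them.\<close>

theorem theorem5p16:
  shows "(\<forall>G :: 'a graph. simple_graph G \<and> no_isolated_vertices G \<longrightarrow>
            (JM (edges G) \<longleftrightarrow> (\<exists>K\<in>six_graphs. graph_iso G K)))
    \<and> (\<forall>K\<in>six_graphs. simple_graph K \<and> no_isolated_vertices K \<and> JM (edges K))
    \<and> card six_graphs = 6
    \<and> pairwise (\<lambda>K K'. \<not> graph_iso K K') six_graphs"
proof (intro conjI allI impI ballI iffI)
  fix G :: "'a graph" assume "simple_graph G \<and> no_isolated_vertices G"
  then have G: "simple_graph G" "no_isolated_vertices G" by simp_all
  have eq: "(\<Union>(edges G), edges G) = G" using graph_as_hypergraph(1)[OF G] by (simp add: prod_eq_iff)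
  show "\<exists>K\<in>six_graphs. graph_iso G K" if "JM (edges G)"
  proof -
    have "critical_graph (edges G)"
      using that G(1) by (intro JM_imp_critical_graph) (simp_all add: simple_graph_def)
    then show ?thesis using critical_graph.isomorphic_six_graphs[of "edges G"] unfolding eq by simp
  qed
  show "JM (edges G)" if "\<exists>K\<in>six_graphs. graph_iso G K"
    using that critical_graph_iso[OF G] critical_six critical_graph.JM by blast
next
  fix K assume K: "K \<in> six_graphs"
  show "simple_graph K" "no_isolated_vertices K" using simple_six[OF K] by simp_all
  show "JM (edges K)" using critical_graph.JM[OF critical_six[OF K]] .
next
  show "card six_graphs = 6" by (rule card_six_graphs)
  show "pairwise (\<lambda>K K'. \<not> graph_iso K K') six_graphs" by (rule six_graphs_nonisomorphic)
qed

end
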